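(* Let $\nu, m, t$ be integers with $t\ge 1$ such that either $\nu\ge m+1=t+2$, or $2\nu\ge\max\{3m+2,\,2m+2t+6\}$ with $m\ge t+2$. Suppose $\mathscr{F}$ is a maximum sized non-trivial $t$-intersecting subfamily of $\mathscr{P}_m$. Then one of the following holds. (i) If $1\le t\le\frac{m}{2}-1$, then $\mathscr{F}=\mathscr{H}_1(T,U)$ for some $T\in\mathscr{P}_t$ and $U\in\mathscr{P}_m$ with $T+U\in\mathscr{P}_{m+1}$ (and $\dim(T\cap U)=t-1$). (ii) If $\frac{m}{2}-1<t\le m-1$, then $\mathscr{F}=\mathscr{H}_2(Z)$ for some $Z\in\mathscr{P}_{t+2}$, or, in the case $(m,t)=(3,1)$, $\mathscr{F}=\mathscr{H}_1(T,U)$ for some $T\in\mathscr{P}_1$ and $U\in\mathscr{P}_3$ with $T+U\in\mathscr{P}_4$.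
   Context: Let $q$ be a prime power, $V$ a $2\nu$-dimensional vector space over the finite field $\mathbb{F}_q$, and $f$ a non-degenerate alternating bilinear form on $V$. A subspace $M$ of $V$ is totally isotropic if $f(x,y)=0$ for all $x,y\in M$. For $0\le m\le\nu$, $\mathscr{P}_m$ denotes the set of all $m$-dimensional totally isotropic subspaces of $V$. A family $\mathscr{F}\subset\mathscr{P}_m$ is $t$-intersecting if $\dim(F_1\cap F_2)\ge t$ for all $F_1,F_2\in\mathscr{F}$. It is trivial if some fixed $t$-dimensional subspace is contained in every member of $\mathscr{F}$, and non-trivial otherwise. "Maximum sized non-trivial $t$-intersecting" means of largest cardinality among all non-trivial $t$-intersecting subfamilies of $\mathscr{P}_m$. For a subspace $A$ of $V$, $\mathscr{M}(m;A)$ denotes the set of all members of $\mathscr{P}_m$ contained in $A$. For $T\in\mathscr{P}_t$ and $U\in\mathscr{P}_m$ with $\dim(T\cap U)=t-1$, put $$\mathscr{H}_1(T,U)=\{F\in\mathscr{P}_m:\ T\subset F,\ \dim(F\cap U)\ge t\}\cup\mathscr{M}(m;T+U).$$ For a $(t+2)$-dimensional subspace $Z$ of $V$, put $$\mathscr{H}_2(Z)=\{F\in\mathscr{P}_m:\ \dim(F\cap Z)\ge t+1\}.$$ *)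

theory Defs
  imports Complex_Main "HOL-Library.Set_Algebras"
begin

text \<open>The finite field is an arbitrary finite type of class \<open>field\<close>, and the vector space \<open>V\<close> is
  the whole type \<open>'v\<close>. Finite dimensionality is assumed explicitly because the library's
  \<open>dim\<close> is 0 on infinite-dimensional spaces.\<close>

locale symplectic_space = vector_space scale
  for scale :: "'k::{field,finite} \<Rightarrow> 'v::ab_group_add \<Rightarrow> 'v" (infixr \<open>*s\<close> 75) +
  fixes f :: "'v \<Rightarrow> 'v \<Rightarrow> 'k" and \<nu> :: nat
  assumes finite_dimensional: "\<exists>B. finite B \<and> span B = UNIV"
    and dim_V: "dim UNIV = 2 * \<nu>"
    and linear_right: "\<And>x. Vector_Spaces.linear scale (*) (\<lambda>y. f x y)"
    and linear_left: "\<And>y. Vector_Spaces.linear scale (*) (\<lambda>x. f x y)"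
    and alternating: "\<And>x. f x x = 0"
    and nondegenerate: "\<And>x. (\<And>y. f x y = 0) \<Longrightarrow> x = 0"
begin

definition totally_isotropic :: "'v set \<Rightarrow> bool" where
  "totally_isotropic M \<longleftrightarrow> subspace M \<and> (\<forall>x\<in>M. \<forall>y\<in>M. f x y = 0)"

definition isotropics :: "nat \<Rightarrow> 'v set set" where
  "isotropics m = {M. totally_isotropic M \<and> dim M = m}"

definition t_intersecting :: "nat \<Rightarrow> 'v set set \<Rightarrow> bool" where
  "t_intersecting t \<F> \<longleftrightarrow> (\<forall>F1\<in>\<F>. \<forall>F2\<in>\<F>. t \<le> dim (F1 \<inter> F2))"

text \<open>The common subspace is any \<open>t\<close>-dimensional subspace of \<open>V\<close>, not necessarily isotropic.\<close>

definition trivial_family :: "nat \<Rightarrow> 'v set set \<Rightarrow> bool" where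
  "trivial_family t \<F> \<longleftrightarrow> (\<exists>E. subspace E \<and> dim E = t \<and> (\<forall>F\<in>\<F>. E \<subseteq> F))"

definition nontrivial_t_intersecting :: "nat \<Rightarrow> nat \<Rightarrow> 'v set set \<Rightarrow> bool" where
  "nontrivial_t_intersecting m t \<F> \<longleftrightarrow>
     \<F> \<subseteq> isotropics m \<and> t_intersecting t \<F> \<and> \<not> trivial_family t \<F>"

definition maximum_nontrivial_t_intersecting :: "nat \<Rightarrow> nat \<Rightarrow> 'v set set \<Rightarrow> bool" where
  "maximum_nontrivial_t_intersecting m t \<F> \<longleftrightarrow>
     nontrivial_t_intersecting m t \<F> \<and>
     (\<forall>\<G>. nontrivial_t_intersecting m t \<G> \<longrightarrow> card \<G> \<le> card \<F>)"

definition isotropics_within :: "nat \<Rightarrow> 'v set \<Rightarrow> 'v set set" where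
  "isotropics_within m A = {F \<in> isotropics m. F \<subseteq> A}"

text \<open>\<open>T + U\<close> is the elementwise sum of sets, which for subspaces is their sum. The families depend
  on \<open>m\<close> and \<open>t\<close>, which are explicit arguments here; \<open>H1 m t T U\<close> is meant for
  \<open>T \<in> isotropics t\<close> and \<open>U \<in> isotropics m\<close> with \<open>dim (T \<inter> U) = t - 1\<close>, and \<open>H2 m t Z\<close> for
  subspaces \<open>Z\<close> of dimension \<open>t + 2\<close>.\<close>

definition H1 :: "nat \<Rightarrow> nat \<Rightarrow> 'v set \<Rightarrow> 'v set \<Rightarrow> 'v set set" where
  "H1 m t T U = {F \<in> isotropics m. T \<subseteq> F \<and> t \<le> dim (F \<inter> U)} \<union> isotropics_within m (T + U)"

definition H2 :: "nat \<Rightarrow> nat \<Rightarrow> 'v set \<Rightarrow> 'v set set" where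
  "H2 m t Z = {F \<in> isotropics m. t + 1 \<le> dim (F \<inter> Z)}"

end

end

theory Submission
  imports Defs "HOL-Library.Cardinality"
begin

text \<open>Call a subspace a \<open>t\<close>-cover of \<open>\<F>\<close> if it meets every member of \<open>\<F>\<close> in dimension at least
  \<open>t\<close>, and let \<open>\<tau>\<close> be the least dimension of a \<open>t\<close>-cover. Averaging over the one-dimensional
  extensions of a subspace shows that \<open>\<tau> \<ge> t + 2\<close> would make \<open>\<F>\<close> smaller than any
  \<open>H1 m t T U\<close>, so \<open>\<tau> = t + 1\<close>. The members of \<open>\<F>\<close> containing no isotropic \<open>(t+1)\<close>-dimensional
  cover are negligible in number, hence there are more than \<open>(q\<^sup>m\<^sup>-\<^sup>t - 1) / (q - 1)\<close> such covers, and by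
  maximality any two of them meet in dimension at least \<open>t\<close>. Either they all share a
  \<open>t\<close>-dimensional subspace \<open>T\<close>, in which case there are so many that they span \<open>T + U\<close> for every
  member \<open>U\<close> not containing \<open>T\<close> and \<open>\<F> = H1 m t T U\<close>; or three of them form a triangle in a
  \<open>(t+2)\<close>-dimensional isotropic \<open>Z\<close> and \<open>\<F> = H2 m t Z\<close>. Comparing the sizes of the two families
  decides which case is possible.\<close>

section \<open>Gaussian numbers\<close>

text \<open>The threshold \<open>qnum q (m - t)\<close> is the number of
  \<open>(t+1)\<close>-dimensional spaces between a \<open>t\<close>-dimensional \<open>T\<close>
  and an \<open>m\<close>-dimensional space containing it; more covers than that through
  \<open>T\<close> must span dimension at least \<open>m + 1\<close>, the dimension of
  \<open>T + U\<close>. With \<open>N k\<close> the number of members of \<open>isotropics m\<close>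
  through a fixed isotropic space of dimension \<open>k\<close>, the benchmark \<open>H1\<close> has
  about \<open>qnum q (m + 1 - t) * N (t + 1)\<close> members. Its excess of about
  \<open>q ^ (m - t) * N (t + 1)\<close> over the threshold times \<open>N (t + 1)\<close> pays for
  the error terms, which are multiples of \<open>N (t + 2)\<close>: the bound
  \<open>2 * m + 2 * t + 6 \<le> 2 * \<nu>\<close> makes \<open>N (t + 1)\<close> at least
  \<open>q ^ (m + t + 5)\<close> times \<open>N (t + 2)\<close>. For \<open>m = t + 1\<close> no
  counting of this kind is needed: the members themselves are \<open>(t+1)\<close>-dimensional
  covers, and non-triviality alone supplies a triangle.\<close>

definition qnum :: "real \<Rightarrow> nat \<Rightarrow> real" where
  "qnum q n = (\<Sum>i<n. q ^ i)"

lemma qnum_0 [simp]: "qnum q 0 = 0"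
  by (simp add: qnum_def)

lemma qnum_Suc: "qnum q (Suc n) = qnum q n + q ^ n"
  by (simp add: qnum_def)

lemma qnum_Suc_0 [simp]: "qnum q (Suc 0) = 1"
  by (simp add: qnum_def)

lemma qnum_add: "qnum q (a + b) = qnum q a + q ^ a * qnum q b"
  by (induction b) (simp_all add: qnum_Suc algebra_simps power_add)

lemma qnum_Suc_shift: "qnum q (Suc n) = 1 + q * qnum q n"
  using qnum_add[of q 1 n] by simp

lemma qnum_mult_minus_1: "(q - 1) * qnum q n = q ^ n - 1"
  by (induction n) (simp_all add: qnum_Suc algebra_simps)

lemma qnum_nonneg: "0 \<le> q \<Longrightarrow> 0 \<le> qnum q n"
  by (simp add: qnum_def sum_nonneg)

lemma qnum_mono: "0 \<le> q \<Longrightarrow> m \<le> n \<Longrightarrow> qnum q m \<le> qnum q n"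
  unfolding qnum_def by (rule sum_mono2) auto

lemma qnum_Suc_ge_power: "0 \<le> q \<Longrightarrow> q ^ n \<le> qnum q (Suc n)"
  by (simp add: qnum_Suc qnum_nonneg)

lemma qnum_ge_1: "0 \<le> q \<Longrightarrow> 0 < n \<Longrightarrow> 1 \<le> qnum q n"
  using qnum_mono[of q 1 n] by simp

lemma qnum_le_power:
  assumes "2 \<le> q" shows "qnum q n \<le> q ^ n"
proof (induction n)
  case (Suc n)
  have "q ^ n + q ^ n \<le> q * q ^ n"
    using assms mult_right_mono[of 2 q "q ^ n"] by simp
  then show ?case using Suc by (simp add: qnum_Suc)
qed simp

lemma qnum_Suc_le:
  assumes "2 \<le> q" shows "qnum q (Suc n) \<le> 2 * q ^ n"
  using qnum_le_power[OF assms, of n] by (simp add: qnum_Suc)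

text \<open>Makes the averaging ratio at a non-cover, \<open>qnum q (m - r) / qnum q (t - r)\<close>
  with \<open>r < t\<close>, at most its value \<open>qnum q (m + 1 - t)\<close> at
  \<open>r = t - 1\<close>.\<close>

lemma qnum_add_le_mult:
  assumes "0 \<le> q" shows "qnum q (b + Suc j) \<le> qnum q (Suc j) * qnum q (Suc b)"
proof -
  have "qnum q (b + Suc j) = qnum q (Suc b) + q ^ b * (q * qnum q j)"
    using qnum_add[of q "Suc b" j] by simp
  also have "\<dots> \<le> qnum q (Suc b) + qnum q (Suc b) * (q * qnum q j)"
    using assms by (intro add_left_mono mult_right_mono qnum_Suc_ge_power) (auto simp: qnum_nonneg)
  also have "\<dots> = qnum q (Suc j) * qnum q (Suc b)"
    by (simp add: qnum_Suc_shift[of q j] algebra_simps)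
  finally show ?thesis .
qed

lemma qnum_add_le:
  assumes "2 \<le> q" shows "qnum q (k + Suc j) \<le> 2 * q ^ k * qnum q (Suc j)"
proof -
  have "qnum q k \<le> q ^ k * qnum q (Suc j)"
    using qnum_le_power[OF assms, of k] qnum_ge_1[of q "Suc j"] assms
      order_trans[OF _ mult_left_mono[of 1 "qnum q (Suc j)" "q ^ k"]] by simp
  then show ?thesis by (simp only: qnum_add)
qed

text \<open>\<open>gauss_binomial q k j\<close> is the Gaussian binomial coefficient of \<open>k + j\<close> over \<open>k\<close>.\<close>

definition gauss_binomial :: "real \<Rightarrow> nat \<Rightarrow> nat \<Rightarrow> real" where
  "gauss_binomial q k j = (\<Prod>i<k. qnum q (j + Suc i) / qnum q (Suc i))"

lemma gauss_binomial_Suc: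
  "gauss_binomial q (Suc k) j = gauss_binomial q k j * (qnum q (j + Suc k) / qnum q (Suc k))"
  by (simp add: gauss_binomial_def)

lemma gauss_binomial_0_right:
  assumes "0 \<le> q" shows "gauss_binomial q k 0 = 1"
proof -
  have "qnum q (Suc i) \<noteq> 0" for i
    using qnum_ge_1[OF assms, of "Suc i"] by simp
  then show ?thesis by (simp add: gauss_binomial_def)
qed

text \<open>The recursion in the other argument. It leads to a bound with \<open>j\<close> factors,
  where \<open>j\<close> will be the excess of a cover's dimension over \<open>t\<close>.\<close>

lemma gauss_binomial_Suc_right:
  assumes "0 \<le> q"
  shows "gauss_binomial q k (Suc j) = gauss_binomial q k j * (qnum q (k + Suc j) / qnum q (Suc j))"
proof (induction k)
  case 0
  have "qnum q (Suc j) \<noteq> 0"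
    using qnum_ge_1[OF assms, of "Suc j"] by simp
  then show ?case by (simp add: gauss_binomial_def)
next
  case (Suc k)
  have "qnum q (k + Suc j) \<noteq> 0" "qnum q (Suc j) \<noteq> 0" "qnum q (Suc k) \<noteq> 0"
    using qnum_ge_1[OF assms, of "k + Suc j"] qnum_ge_1[OF assms, of "Suc j"]
      qnum_ge_1[OF assms, of "Suc k"] by auto
  then show ?case
    using Suc by (simp add: gauss_binomial_Suc field_simps)
qed

lemma gauss_binomial_le:
  assumes "2 \<le> q" shows "gauss_binomial q k j \<le> (2 * q ^ k) ^ j"
proof (induction j)
  case 0
  then show ?case using assms by (simp add: gauss_binomial_0_right)
next
  case (Suc j)
  have "qnum q (Suc j) > 0"
    using qnum_ge_1[of q "Suc j"] assms by simp
  then have "qnum q (k + Suc j) / qnum q (Suc j) \<le> 2 * q ^ k"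
    using qnum_add_le[OF assms, of k j] by (simp add: divide_le_eq)
  then have "gauss_binomial q k j * (qnum q (k + Suc j) / qnum q (Suc j))
      \<le> (2 * q ^ k) ^ j * (2 * q ^ k)"
    using assms Suc by (intro mult_mono) (auto simp: qnum_nonneg)
  then show ?case using assms by (simp add: gauss_binomial_Suc_right mult_ac)
qed

lemma gauss_binomial_1:
  assumes "0 \<le> q" shows "gauss_binomial q k 1 = qnum q (Suc k)"
  using gauss_binomial_Suc_right[OF assms, of k 0] assms by (simp add: gauss_binomial_0_right)

section \<open>Counting subspaces over a finite field\<close>

text \<open>The field size is carried as a real number so that counts can be subtracted and divided
  without truncation.\<close>

locale finite_field_vector_space = finite_dimensional_vector_space scale Basis
  for scale :: "'k::{field,finite} \<Rightarrow> 'v::ab_group_add \<Rightarrow> 'v" (infixr \<open>*s\<close> 75)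
    and Basis :: "'v set" +
  fixes q :: real
  assumes q_eq: "q = real CARD('k)"
begin

lemma card_field_ge_2: "2 \<le> CARD('k)"
  using card_mono[of "UNIV :: 'k set" "{0, 1}"] by simp

lemma q_ge_2: "2 \<le> q"
  using card_field_ge_2 by (simp add: q_eq)

lemma q_ge_0 [simp]: "0 \<le> q"
  using q_ge_2 by simp

lemma card_span_independent:
  assumes "finite B" "independent B"
  shows "finite (span B) \<and> card (span B) = CARD('k) ^ card B"
  using assms
proof (induction B rule: finite_induct)
  case (insert b B)
  then have b: "b \<notin> span B" and B: "independent B"
    by (auto simp: independent_insert)
  let ?g = "\<lambda>(c, x). c *s b + x"
  have inj: "inj_on ?g (UNIV \<times> span B)"
  proof (rule inj_onI, clarify)
    fix c x d y assume xy: "x \<in> span B" "y \<in> span B" "c *s b + x = d *s b + y"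
    then have eq: "(c - d) *s b = y - x"
      by (simp add: scale_left_diff_distrib algebra_simps)
    have "c = d"
    proof (rule ccontr)
      assume "c \<noteq> d"
      have "(c - d) *s b \<in> span B" unfolding eq using xy by (simp add: span_diff)
      then have "inverse (c - d) *s ((c - d) *s b) \<in> span B" by (rule span_scale)
      with \<open>c \<noteq> d\<close> b show False by simp
    qed
    with xy show "c = d \<and> x = y" by simp
  qed
  have im: "span (insert b B) = ?g ` (UNIV \<times> span B)"
  proof safe
    fix x assume "x \<in> span (insert b B)"
    then obtain c where "x - c *s b \<in> span B" by (auto simp: span_insert)
    then show "x \<in> ?g ` (UNIV \<times> span B)"
      by (intro image_eqI[of _ _ "(c, x - c *s b)"]) auto
  next
    fix c x assume "x \<in> span B"
    then show "c *s b + x \<in> span (insert b B)"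
      by (auto simp: span_insert intro: exI[of _ c])
  qed
  have "finite (span B)" "card (span B) = CARD('k) ^ card B"
    using insert.IH B by auto
  then show ?case
    using insert.hyps by (simp add: im card_image[OF inj] card_cartesian_product)
qed simp

lemma finite_subspace: "subspace W \<Longrightarrow> finite W"
  and card_subspace: "subspace W \<Longrightarrow> card W = CARD('k) ^ dim W"
proof -
  assume "subspace W"
  then obtain B where "finite B" "independent B" "span B = W" "card B = dim W"
    using basis_subspace_exists by metis
  then show "finite W" "card W = CARD('k) ^ dim W"
    using card_span_independent[of B] by simp_all
qed

lemma finite_UNIV_vectors [simp]: "finite (A :: 'v set)"
  by (rule finite_subset[OF subset_UNIV finite_subspace[OF subspace_UNIV]])

lemma finite_set_of_sets [simp]: "finite (\<A> :: 'v set set)"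
proof -
  have "finite (Pow (UNIV :: 'v set))" by (simp only: finite_Pow_iff finite_UNIV_vectors)
  then show ?thesis by (rule rev_finite_subset) auto
qed

lemma subspace_eqI:
  "subspace A \<Longrightarrow> subspace B \<Longrightarrow> A \<subseteq> B \<Longrightarrow> dim B \<le> dim A \<Longrightarrow> A = B"
  by (rule subspace_dim_equal)

lemma dim_less: "subspace A \<Longrightarrow> subspace B \<Longrightarrow> A \<subset> B \<Longrightarrow> dim A < dim B"
  by (metis dim_psubset span_eq_iff)

lemma subspace_set_plus: "subspace A \<Longrightarrow> subspace B \<Longrightarrow> subspace (A + B)"
proof -
  have "A + B = {x + y |x y. x \<in> A \<and> y \<in> B}"
    by (auto simp: set_plus_def)
  then show "subspace A \<Longrightarrow> subspace B \<Longrightarrow> ?thesis" using subspace_sums[of A B] by simp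
qed

lemma subset_set_plus:
  assumes "subspace A" "subspace B" shows "A \<subseteq> A + B" "B \<subseteq> A + B"
  using set_plus_intro[of _ A 0 B] set_plus_intro[of 0 A _ B] assms
  by (auto simp: subspace_0)

lemma set_plus_subset:
  assumes "subspace C" "A \<subseteq> C" "B \<subseteq> C" shows "A + B \<subseteq> C"
  using assms by (auto simp: set_plus_def intro!: subspace_add)

lemma dim_set_plus:
  assumes "subspace A" "subspace B" shows "dim (A + B) + dim (A \<inter> B) = dim A + dim B"
proof -
  have "A + B = {x + y |x y. x \<in> A \<and> y \<in> B}"
    by (auto simp: set_plus_def)
  then show ?thesis using dim_sums_Int[OF assms] by simp
qed

text \<open>Cover is meant here in the lattice sense and is unrelated to \<open>t_cover\<close>. The
  elements correspond to the points of the projective space of \<open>W / S\<close>.\<close>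

definition covers_within :: "'v set \<Rightarrow> 'v set \<Rightarrow> 'v set set" where
  "covers_within S W = {R. subspace R \<and> S \<subseteq> R \<and> R \<subseteq> W \<and> dim R = Suc (dim S)}"

lemma span_insert_in_covers_within:
  assumes "subspace S" "subspace W" "S \<subseteq> W" "v \<in> W - S"
  shows "span (insert v S) \<in> covers_within S W"
  using assms by (auto simp: covers_within_def dim_insert span_base span_minimal
      intro: set_mp[OF span_superset])  (metis span_eq_iff)

lemma covers_within_eq_span_insert:
  assumes "subspace S" "R \<in> covers_within S W" "v \<in> R - S"
  shows "R = span (insert v S)"
proof -
  have "span (insert v S) \<subseteq> R"
    using assms by (intro span_minimal) (auto simp: covers_within_def)
  moreover have "dim (span (insert v S)) = dim R"
    using assms by (simp add: covers_within_def dim_insert) (metis span_eq_iff)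
  ultimately show ?thesis
    using assms subspace_eqI[of "span (insert v S)" R] by (auto simp: covers_within_def)
qed

text \<open>The sets \<open>R - S\<close> partition \<open>W - S\<close>, and each has
  \<open>q ^ dim S * (q - 1)\<close> elements.\<close>

lemma card_covers_within:
  assumes S: "subspace S" and W: "subspace W" and "S \<subseteq> W"
  shows "real (card (covers_within S W)) = qnum q (dim W - dim S)"
proof -
  let ?s = "dim S" and ?C = "covers_within S W"
  have le: "?s \<le> dim W" using \<open>S \<subseteq> W\<close> by (rule dim_subset)
  have "W - S = (\<Union>R\<in>?C. R - S)"
  proof (intro equalityI subsetI)
    fix v assume "v \<in> W - S"
    then show "v \<in> (\<Union>R\<in>?C. R - S)"
      using span_insert_in_covers_within[OF assms, of v] span_base[of v "insert v S"] by auto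
  qed (auto simp: covers_within_def)
  moreover have disj: "(R - S) \<inter> (R' - S) = {}" if "R \<in> ?C" "R' \<in> ?C" "R \<noteq> R'" for R R'
    using covers_within_eq_span_insert[OF S] that by blast
  moreover have "card (\<Union>R\<in>?C. R - S) = (\<Sum>R\<in>?C. card (R - S))"
    using disj by (intro card_UN_disjoint) auto
  ultimately have "card (W - S) = (\<Sum>R\<in>?C. card (R - S))"
    by (simp only:)
  moreover have "real (card (R - S)) = q ^ ?s * (q - 1)" if "R \<in> ?C" for R
    using that S card_mono[of R S]
    by (simp add: card_Diff_subset covers_within_def card_subspace q_eq of_nat_diff algebra_simps)
  ultimately have "real (card (W - S)) = real (card ?C) * (q ^ ?s * (q - 1))"
    by simp
  moreover have "real (card (W - S)) = q ^ ?s * ((q - 1) * qnum q (dim W - ?s))"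
    using assms card_mono[of W S] le
    by (simp add: card_Diff_subset card_subspace q_eq of_nat_diff qnum_mult_minus_1
        right_diff_distrib flip: power_add)
  ultimately show ?thesis
    using q_ge_2 by simp
qed

lemma sum_card_containing:
  "(\<Sum>R\<in>\<R>. card {F\<in>\<G>. R \<subseteq> F}) = (\<Sum>F\<in>\<G>. card {R\<in>\<R>. R \<subseteq> (F :: 'v set)})"
  by (rule sum_multicount_gen) auto

lemma covers_within_subset:
  "{R \<in> covers_within S W. R \<subseteq> F} = covers_within S (F \<inter> W)"
  by (auto simp: covers_within_def)

text \<open>Double counting of pairs \<open>R \<subseteq> F\<close>: the extensions of
  \<open>S\<close> inside \<open>W\<close> that lie in \<open>F\<close> are exactly those inside
  \<open>F \<inter> W\<close>.\<close>

lemma sum_covers_within: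
  assumes "subspace S" "subspace W" "S \<subseteq> W" and "\<And>F. F \<in> \<G> \<Longrightarrow> subspace F \<and> S \<subseteq> F"
  shows "(\<Sum>R\<in>covers_within S W. real (card {F\<in>\<G>. R \<subseteq> F}))
    = (\<Sum>F\<in>\<G>. qnum q (dim (F \<inter> W) - dim S))"
proof -
  have "(\<Sum>R\<in>covers_within S W. real (card {F\<in>\<G>. R \<subseteq> F}))
      = (\<Sum>F\<in>\<G>. real (card {R\<in>covers_within S W. R \<subseteq> F}))"
    using arg_cong[OF sum_card_containing, of real] by simp
  also have "\<dots> = (\<Sum>F\<in>\<G>. qnum q (dim (F \<inter> W) - dim S))"
    using assms by (intro sum.cong) (auto simp: covers_within_subset card_covers_within subspace_inter)
  finally show ?thesis .
qed

text \<open>Pigeonhole: every member of the family contains at least \<open>qnum q k\<close> of the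
  \<open>qnum q n\<close> extensions, so some extension receives the average share.\<close>

lemma exists_cover_averaging:
  assumes "subspace S" "subspace W" "S \<subseteq> W" "dim W = dim S + n" "k \<le> n" "0 < k"
    and \<G>: "\<And>F. F \<in> \<G> \<Longrightarrow> subspace F \<and> S \<subseteq> F \<and> dim S + k \<le> dim (F \<inter> W)"
  shows "\<exists>R\<in>covers_within S W.
    qnum q k * real (card \<G>) \<le> qnum q n * real (card {F\<in>\<G>. R \<subseteq> F})"
proof (rule ccontr)
  let ?C = "covers_within S W"
  assume "\<not> ?thesis"
  then have less: "qnum q n * real (card {F\<in>\<G>. R \<subseteq> F}) < qnum q k * real (card \<G>)" if "R \<in> ?C" for R
    using that by force
  have C: "real (card ?C) = qnum q n" and n: "1 \<le> qnum q n"
    using assms by (auto simp: card_covers_within intro: qnum_ge_1)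
  then have "?C \<noteq> {}" by auto
  with less have "(\<Sum>R\<in>?C. qnum q n * real (card {F\<in>\<G>. R \<subseteq> F})) < (\<Sum>R\<in>?C. qnum q k * real (card \<G>))"
    by (intro sum_strict_mono) auto
  also have "\<dots> = qnum q n * (\<Sum>F\<in>\<G>. qnum q k)"
    using C by simp
  also have "\<dots> \<le> qnum q n * (\<Sum>F\<in>\<G>. qnum q (dim (F \<inter> W) - dim S))"
    using n \<G> by (intro mult_left_mono sum_mono qnum_mono) fastforce+
  also have "\<dots> = (\<Sum>R\<in>?C. qnum q n * real (card {F\<in>\<G>. R \<subseteq> F}))"
    using assms sum_covers_within[of S W \<G>] by (simp flip: sum_distrib_left)
  finally show False by simp
qed

text \<open>Repeating the one-step averaging \<open>k\<close> times multiplies the ratios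
  \<open>qnum q (j + i) / qnum q i\<close> for \<open>i = k, ..., 1\<close>, which gives the
  Gaussian binomial.\<close>

lemma exists_subspace_averaging:
  assumes "subspace S" "subspace W" "S \<subseteq> W" "dim W = dim S + k + j"
    and "\<And>F. F \<in> \<G> \<Longrightarrow> subspace F \<and> S \<subseteq> F \<and> dim S + k \<le> dim (F \<inter> W)"
  shows "\<exists>R. subspace R \<and> S \<subseteq> R \<and> R \<subseteq> W \<and> dim R = dim S + k \<and>
    real (card \<G>) \<le> gauss_binomial q k j * real (card {F\<in>\<G>. R \<subseteq> F})"
  using assms
proof (induction k arbitrary: S \<G>)
  case 0
  have "{F\<in>\<G>. S \<subseteq> F} = \<G>" using 0 by auto
  with 0 show ?case by (intro exI[of _ S]) (auto simp: gauss_binomial_def)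
next
  case (Suc k)
  then have "\<exists>R\<in>covers_within S W. qnum q (Suc k) * real (card \<G>)
      \<le> qnum q (j + Suc k) * real (card {F\<in>\<G>. R \<subseteq> F})"
    by (intro exists_cover_averaging) auto
  then obtain R where R: "subspace R" "S \<subseteq> R" "R \<subseteq> W" "dim R = Suc (dim S)"
    and le: "qnum q (Suc k) * real (card \<G>) \<le> qnum q (j + Suc k) * real (card {F\<in>\<G>. R \<subseteq> F})"
    by (auto simp: covers_within_def)
  let ?G = "{F\<in>\<G>. R \<subseteq> F}"
  have "\<exists>R'. subspace R' \<and> R \<subseteq> R' \<and> R' \<subseteq> W \<and> dim R' = dim R + k \<and>
    real (card ?G) \<le> gauss_binomial q k j * real (card {F\<in>?G. R' \<subseteq> F})"
    using R Suc.prems by (intro Suc.IH) auto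
  then obtain R' where R': "subspace R'" "R \<subseteq> R'" "R' \<subseteq> W" "dim R' = dim R + k"
    and le': "real (card ?G) \<le> gauss_binomial q k j * real (card {F\<in>?G. R' \<subseteq> F})"
    by blast
  have eq: "{F\<in>?G. R' \<subseteq> F} = {F\<in>\<G>. R' \<subseteq> F}" using R' by auto
  have pos: "0 < qnum q (Suc k)" using qnum_ge_1[of q "Suc k"] by simp
  have "real (card \<G>) \<le> qnum q (j + Suc k) / qnum q (Suc k) * real (card ?G)"
    using le pos by (simp add: field_simps)
  also have "\<dots> \<le> qnum q (j + Suc k) / qnum q (Suc k)
      * (gauss_binomial q k j * real (card {F\<in>\<G>. R' \<subseteq> F}))"
    using le' unfolding eq by (intro mult_left_mono) (auto simp: qnum_nonneg)
  finally show ?case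
    using R R' by (intro exI[of _ R']) (auto simp: gauss_binomial_Suc mult_ac)
qed

text \<open>Instead of duality, pairs of an extension \<open>R\<close> of \<open>S\<close> and a
  hyperplane containing \<open>R\<close> are counted twice. By induction each \<open>R\<close> lies
  in \<open>qnum q (Suc n)\<close> hyperplanes, and each hyperplane contains equally many
  \<open>R\<close>, so there are as many hyperplanes as extensions.\<close>

lemma card_hyperplanes_containing:
  assumes "subspace S" "subspace W" "S \<subseteq> W" "dim W = dim S + Suc n"
  shows "real (card {H. subspace H \<and> S \<subseteq> H \<and> H \<subseteq> W \<and> Suc (dim H) = dim W}) = qnum q (Suc n)"
  using assms
proof (induction n arbitrary: S)
  case 0
  then have "{H. subspace H \<and> S \<subseteq> H \<and> H \<subseteq> W \<and> Suc (dim H) = dim W} = {S}"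
    using subspace_eqI[of S] by force
  then show ?case by simp
next
  case (Suc n)
  let ?H = "{H. subspace H \<and> S \<subseteq> H \<and> H \<subseteq> W \<and> Suc (dim H) = dim W}"
  have "(\<Sum>R\<in>covers_within S W. real (card {F\<in>?H. R \<subseteq> F})) = (\<Sum>F\<in>?H. qnum q (dim (F \<inter> W) - dim S))"
    using Suc.prems by (intro sum_covers_within) auto
  also have "\<dots> = (\<Sum>F\<in>?H. qnum q (Suc n))"
    using Suc.prems by (intro sum.cong) (auto simp: Int_absorb2)
  finally have "(\<Sum>R\<in>covers_within S W. real (card {F\<in>?H. R \<subseteq> F})) = real (card ?H) * qnum q (Suc n)"
    by simp
  moreover have "real (card {F\<in>?H. R \<subseteq> F}) = qnum q (Suc n)" if R: "R \<in> covers_within S W" for R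
  proof -
    have "{F\<in>?H. R \<subseteq> F} = {H. subspace H \<and> R \<subseteq> H \<and> H \<subseteq> W \<and> Suc (dim H) = dim W}"
      using R by (auto simp: covers_within_def)
    then show ?thesis
      using Suc.IH[of R] Suc.prems R by (simp add: covers_within_def)
  qed
  moreover have "real (card (covers_within S W)) = qnum q (Suc (Suc n))"
    using Suc.prems by (simp add: card_covers_within)
  moreover have "1 \<le> qnum q (Suc n)" by (simp add: qnum_ge_1)
  ultimately show ?case by simp
qed

lemma card_hyperplanes:
  assumes "subspace W" "0 < dim W"
  shows "real (card {H. subspace H \<and> H \<subseteq> W \<and> Suc (dim H) = dim W}) = qnum q (dim W)"
proof -
  have "{H. subspace H \<and> {0} \<subseteq> H \<and> H \<subseteq> W \<and> Suc (dim H) = dim W}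
      = {H. subspace H \<and> H \<subseteq> W \<and> Suc (dim H) = dim W}"
    by (auto simp: subspace_0)
  then show ?thesis
    using card_hyperplanes_containing[of "{0}" W "dim W - 1"] assms by (auto simp: subspace_0)
qed

end

section \<open>Counting totally isotropic subspaces\<close>

text \<open>The number of \<open>m\<close>-dimensional totally isotropic subspaces of a \<open>2n\<close>-dimensional space through a
  fixed \<open>i\<close>-dimensional one \<open>A\<close> satisfies a recursion in \<open>i\<close>, by counting the one-dimensional extensions
  of \<open>A\<close> inside its orthogonal complement, of dimension \<open>2n - i\<close>.\<close>

definition iso_count :: "real \<Rightarrow> nat \<Rightarrow> nat \<Rightarrow> nat \<Rightarrow> real" where
  "iso_count q n m k = (\<Prod>i\<in>{k..<m}. qnum q (2 * (n - i)) / qnum q (m - i))"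

lemma iso_count_refl [simp]: "iso_count q n m m = 1"
  by (simp add: iso_count_def)

lemma iso_count_rec:
  assumes "0 \<le> q" "k < m"
  shows "qnum q (m - k) * iso_count q n m k = qnum q (2 * (n - k)) * iso_count q n m (Suc k)"
  using assms qnum_ge_1[of q "m - k"] by (simp add: iso_count_def prod.atLeast_Suc_lessThan)

lemma iso_count_pos:
  assumes "0 \<le> q" "m \<le> n" shows "0 < iso_count q n m k"
  unfolding iso_count_def
proof (intro prod_pos ballI divide_pos_pos)
  fix i assume "i \<in> {k..<m}"
  then show "0 < qnum q (2 * (n - i))" "0 < qnum q (m - i)"
    using assms qnum_ge_1[of q "2 * (n - i)"] qnum_ge_1[of q "m - i"] by auto
qed

lemma iso_count_ge_1:
  assumes "0 \<le> q" "m \<le> n" shows "1 \<le> iso_count q n m k"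
  unfolding iso_count_def
proof (intro prod_ge_1)
  fix i assume "i \<in> {k..<m}"
  then show "1 \<le> qnum q (2 * (n - i)) / qnum q (m - i)"
    using assms qnum_ge_1[of q "m - i"] qnum_mono[of q "m - i" "2 * (n - i)"] by auto
qed

text \<open>The ratio of consecutive counts is \<open>qnum q (2 * (n - k)) / qnum q (m - k)\<close>,
  at least \<open>q\<close> to the difference \<open>2 * n - m - k\<close> of the two arguments. All
  later gaps between counts come from here.\<close>

lemma iso_count_ge:
  assumes "2 \<le> q" "m \<le> n" "k < m" "m + k + e \<le> 2 * n"
  shows "q ^ e * iso_count q n m (Suc k) \<le> iso_count q n m k"
proof -
  have pos: "0 < iso_count q n m (Suc k)"
    using assms by (intro iso_count_pos) auto
  have "q ^ e * qnum q (m - k) \<le> qnum q (e + (m - k))"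
    using assms unfolding qnum_add by (simp add: qnum_nonneg)
  also have "\<dots> \<le> qnum q (2 * (n - k))"
    using assms by (intro qnum_mono) auto
  finally have "q ^ e * qnum q (m - k) * iso_count q n m (Suc k)
      \<le> qnum q (2 * (n - k)) * iso_count q n m (Suc k)"
    using pos by (intro mult_right_mono) auto
  also have "\<dots> = qnum q (m - k) * iso_count q n m k"
    using assms by (simp add: iso_count_rec)
  finally have "qnum q (m - k) * (q ^ e * iso_count q n m (Suc k)) \<le> qnum q (m - k) * iso_count q n m k"
    by (simp add: mult_ac)
  then show ?thesis
    using assms qnum_ge_1[of q "m - k"] by simp
qed

locale symplectic_counting = symplectic_space scale f \<nu> + finite_field_vector_space scale Basis q
  for scale :: "'k::{field,finite} \<Rightarrow> 'v::ab_group_add \<Rightarrow> 'v" (infixr \<open>*s\<close> 75)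
    and f :: "'v \<Rightarrow> 'v \<Rightarrow> 'k" and \<nu> :: nat and Basis :: "'v set" and q :: real
begin

section \<open>The alternating form and orthogonal complements\<close>

lemma form_add_right: "f x (y + z) = f x y + f x z"
  and form_scale_right: "f x (c *s y) = c * f x y"
proof -
  interpret r: Vector_Spaces.linear scale "(*)" "\<lambda>y. f x y" by (rule linear_right)
  show "f x (y + z) = f x y + f x z" "f x (c *s y) = c * f x y"
    by (rule r.add r.scale)+
qed

lemma form_add_left: "f (y + z) x = f y x + f z x"
proof -
  interpret r: Vector_Spaces.linear scale "(*)" "\<lambda>y. f y x" by (rule linear_left)
  show ?thesis by (rule r.add)
qed

lemma form_0_right [simp]: "f x 0 = 0"
  using form_scale_right[of x 0 0] by simp

lemma form_skew: "f x y = - f y x"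
proof -
  have "0 = f (x + y) (x + y)" by (simp only: alternating)
  also have "\<dots> = f x y + f y x"
    by (simp only: form_add_left form_add_right) (simp add: alternating)
  finally have "f x y + f y x = 0" by (rule sym)
  then show ?thesis by (simp only: eq_neg_iff_add_eq_0)
qed

lemma form_eq_0_commute: "f x y = 0 \<longleftrightarrow> f y x = 0"
  using form_skew[of x y] by simp

definition perp :: "'v set \<Rightarrow> 'v set" where
  "perp A = {x. \<forall>a\<in>A. f a x = 0}"

lemma subspace_perp: "subspace (perp A)"
  by (auto simp: perp_def subspace_def form_add_right form_scale_right)

lemma span_subset_perp: "X \<subseteq> perp A \<Longrightarrow> span X \<subseteq> perp A"
  by (rule span_minimal[OF _ subspace_perp])

lemma subset_perp_commute: "A \<subseteq> perp B \<longleftrightarrow> B \<subseteq> perp A"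
  unfolding perp_def using form_eq_0_commute by blast

lemma totally_isotropic_iff: "totally_isotropic M \<longleftrightarrow> subspace M \<and> M \<subseteq> perp M"
  by (auto simp: totally_isotropic_def perp_def)

text \<open>Orthogonality is symmetric, so the passage from \<open>X\<close> to its span can be made
  on one side of the form and then on the other.\<close>

lemma totally_isotropic_span:
  assumes "X \<subseteq> perp X" shows "totally_isotropic (span X)"
  using span_subset_perp[OF assms] span_subset_perp subset_perp_commute
  by (auto simp: totally_isotropic_iff)

text \<open>Each vector of \<open>W\<close> is uniquely a multiple of \<open>w\<close> plus an
  element of the kernel of \<open>f a\<close> on \<open>W\<close>.\<close>

lemma card_functional_kernel:
  assumes W: "subspace W" and w: "w \<in> W" "f a w \<noteq> 0"
  shows "card W = CARD('k) * card {x \<in> W. f a x = 0}"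
proof -
  let ?K = "{x \<in> W. f a x = 0}" and ?g = "\<lambda>(c, x). c *s w + x"
  have inj: "inj_on ?g (UNIV \<times> ?K)"
  proof (rule inj_onI, clarify)
    fix c x d y assume xy: "f a x = 0" "f a y = 0" and eq: "c *s w + x = d *s w + y"
    from arg_cong[OF eq, of "f a"] xy w have "c = d"
      by (simp add: form_add_right form_scale_right)
    with eq show "c = d \<and> x = y" by simp
  qed
  have "W = ?g ` (UNIV \<times> ?K)"
  proof safe
    fix x assume "x \<in> W"
    let ?c = "f a x / f a w"
    have "f a (x - ?c *s w) = 0"
      using form_add_right[of a "x - ?c *s w" "?c *s w"] w by (simp add: form_scale_right)
    then show "x \<in> ?g ` (UNIV \<times> ?K)"
      using W w \<open>x \<in> W\<close>
      by (intro image_eqI[of _ _ "(?c, x - ?c *s w)"]) (auto intro: subspace_diff subspace_scale)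
  qed (use W w in \<open>auto intro: subspace_add subspace_scale\<close>)
  then have "card W = card (?g ` (UNIV \<times> ?K))" by (rule arg_cong)
  then show ?thesis by (simp add: card_image[OF inj] card_cartesian_product)
qed

text \<open>Count the pairs \<open>(a, x)\<close> with \<open>a \<in> A\<close> and \<open>f a x = 0\<close> in two ways.\<close>

lemma dim_perp:
  assumes A: "subspace A" shows "dim (perp A) + dim A = 2 * \<nu>"
proof -
  let ?k = "dim A" and ?n = "2 * \<nu>" and ?P = "perp A"
  have dimU: "dim (UNIV :: 'v set) = ?n" by (rule dim_V)
  have cU: "card (UNIV :: 'v set) = CARD('k) ^ ?n"
    by (simp only: card_subspace[OF subspace_UNIV] dimU)
  have cA: "card A = CARD('k) ^ ?k" using A by (rule card_subspace)
  have "(\<Sum>x\<in>UNIV. card {a\<in>A. f a x = 0}) = (\<Sum>a\<in>A. card {x\<in>UNIV. f a x = 0})"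
    by (rule sum_multicount_gen) auto
  then have *: "(\<Sum>x\<in>UNIV. q * real (card {a\<in>A. f a x = 0})) = (\<Sum>a\<in>A. q * real (card {x\<in>UNIV. f a x = 0}))"
    by (simp only: flip: sum_distrib_left of_nat_sum)
  \<comment> \<open>The factor \<open>q\<close> avoids division: a nonzero functional on
    \<open>A\<close> vanishes on a \<open>q\<close>-th part of \<open>A\<close>, and a zero
    functional on all of it.\<close>
  have "(\<Sum>x\<in>UNIV. q * real (card {a\<in>A. f a x = 0}))
      = (\<Sum>x\<in>UNIV. if x \<in> ?P then q * q ^ ?k else q ^ ?k)"
  proof (rule sum.cong)
    fix x :: 'v
    show "q * real (card {a\<in>A. f a x = 0}) = (if x \<in> ?P then q * q ^ ?k else q ^ ?k)"
    proof (cases "x \<in> ?P")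
      case True
      then have "{a\<in>A. f a x = 0} = A" by (auto simp: perp_def)
      with True show ?thesis by (simp add: cA q_eq)
    next
      case False
      then obtain a where "a \<in> A" "f x a \<noteq> 0"
        by (auto simp: perp_def form_eq_0_commute[of _ x])
      from card_functional_kernel[OF A this] False show ?thesis
        by (simp add: cA q_eq form_eq_0_commute[of _ x] flip: of_nat_power of_nat_mult)
    qed
  qed simp
  also have "\<dots> = real (card ?P) * (q * q ^ ?k) + (q ^ ?n - real (card ?P)) * q ^ ?k"
  proof -
    have "card (- ?P) = card (UNIV :: 'v set) - card ?P"
      by (simp add: Compl_eq_Diff_UNIV card_Diff_subset)
    moreover have "card ?P \<le> card (UNIV :: 'v set)" by (intro card_mono) auto
    ultimately have "real (card (- ?P)) = q ^ ?n - real (card ?P)"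
      by (simp add: cU q_eq of_nat_diff)
    then show ?thesis by (simp add: sum.If_cases)
  qed
  finally have L: "(\<Sum>x\<in>UNIV. q * real (card {a\<in>A. f a x = 0}))
    = real (card ?P) * (q * q ^ ?k) + (q ^ ?n - real (card ?P)) * q ^ ?k" .
  have "q * real (card {x\<in>UNIV. f a x = 0}) = q ^ ?n" if a: "a \<in> A - {0}" for a
  proof -
    obtain y where "f a y \<noteq> 0" using nondegenerate[of a] a by blast
    from card_functional_kernel[OF subspace_UNIV UNIV_I this] show ?thesis
      by (simp add: cU q_eq flip: of_nat_power of_nat_mult)
  qed
  moreover have "0 \<in> A" using A by (rule subspace_0)
  moreover have "f 0 x = 0" for x using form_eq_0_commute[of x 0] by simp
  ultimately have "(\<Sum>a\<in>A. q * real (card {x\<in>UNIV. f a x = 0}))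
      = q * q ^ ?n + (\<Sum>a\<in>A - {0}. q ^ ?n)"
    by (simp add: sum.remove[of A 0] cU q_eq)
  also have "\<dots> = q * q ^ ?n + (q ^ ?k - 1) * q ^ ?n"
    using \<open>0 \<in> A\<close> by (simp add: cA q_eq of_nat_diff)
  \<comment> \<open>Both double counts contain \<open>q ^ ?n * q ^ ?k\<close>; after cancelling it,
    a common factor \<open>q - 1\<close> remains.\<close>
  finally have "(q - 1) * (real (card ?P) * q ^ ?k) = (q - 1) * q ^ ?n"
    using L * by (simp add: algebra_simps)
  then have "q ^ (dim ?P + ?k) = q ^ ?n"
    using q_ge_2 by (simp add: card_subspace[OF subspace_perp] q_eq power_add)
  then show ?thesis
    using q_ge_2 by (simp add: power_inject_exp)
qed

section \<open>Isotropic subspaces through a given one\<close>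

lemma isotropicsD:
  assumes "A \<in> isotropics k"
  shows "subspace A" "dim A = k" "A \<subseteq> perp A"
  using assms by (auto simp: isotropics_def totally_isotropic_iff)

lemma totally_isotropic_subset:
  "totally_isotropic F \<Longrightarrow> subspace S \<Longrightarrow> S \<subseteq> F \<Longrightarrow> totally_isotropic S"
  by (auto simp: totally_isotropic_def)

lemma isotropics_subset:
  "F \<in> isotropics m \<Longrightarrow> subspace S \<Longrightarrow> S \<subseteq> F \<Longrightarrow> S \<in> isotropics (dim S)"
  by (auto simp: isotropics_def intro: totally_isotropic_subset)

lemma covers_within_perp_isotropic:
  assumes A: "A \<in> isotropics k" and R: "R \<in> covers_within A (perp A)"
  shows "R \<in> isotropics (Suc k)"
proof -
  have "A \<noteq> R" "A \<subseteq> R" using R by (auto simp: covers_within_def)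
  then obtain v where v: "v \<in> R - A" by blast
  then have eq: "R = span (insert v A)"
    using A R by (intro covers_within_eq_span_insert) (auto dest: isotropicsD)
  have "v \<in> perp A" using v R by (auto simp: covers_within_def)
  then have "insert v A \<subseteq> perp (insert v A)"
    using isotropicsD(3)[OF A] by (auto simp: perp_def alternating form_eq_0_commute[of v])
  then have "totally_isotropic R" unfolding eq by (rule totally_isotropic_span)
  then show ?thesis using A R by (auto simp: isotropics_def covers_within_def)
qed

lemma card_isotropics_containing:
  assumes "A \<in> isotropics k" "k \<le> m"
  shows "real (card {F \<in> isotropics m. A \<subseteq> F}) = iso_count q \<nu> m k"
  using assms
proof (induction "m - k" arbitrary: k A)
  case 0
  then have "m = k" by simp
  have "F = A" if "F \<in> isotropics m" "A \<subseteq> F" for F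
    using subspace_eqI[of A F] that isotropicsD[OF that(1)] isotropicsD[OF 0(2)] \<open>m = k\<close> by simp
  then have "{F \<in> isotropics m. A \<subseteq> F} = {A}"
    using 0 \<open>m = k\<close> by auto
  with \<open>m = k\<close> show ?case by simp
next
  case (Suc d)
  then have k: "k < m" and A: "subspace A" "dim A = k" "A \<subseteq> perp A"
    by (auto dest: isotropicsD)
  let ?G = "{F \<in> isotropics m. A \<subseteq> F}" and ?C = "covers_within A (perp A)"
  have "dim (perp A) - k = 2 * (\<nu> - k)" using dim_perp[OF A(1)] A by simp
  then have C: "real (card ?C) = qnum q (2 * (\<nu> - k))"
    using card_covers_within[OF A(1) subspace_perp A(3)] A by simp
  have "(\<Sum>R\<in>?C. real (card {F\<in>?G. R \<subseteq> F})) = (\<Sum>F\<in>?G. qnum q (dim (F \<inter> perp A) - dim A))"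
    using A by (intro sum_covers_within subspace_perp) (auto dest: isotropicsD)
  also have "\<dots> = (\<Sum>F\<in>?G. qnum q (m - k))"
  proof (intro sum.cong refl)
    fix F assume F: "F \<in> ?G"
    then have "F \<inter> perp A = F" by (auto simp: isotropics_def totally_isotropic_def perp_def)
    then show "qnum q (dim (F \<inter> perp A) - dim A) = qnum q (m - k)"
      using F A by (auto dest: isotropicsD)
  qed
  finally have "(\<Sum>R\<in>?C. real (card {F\<in>?G. R \<subseteq> F})) = real (card ?G) * qnum q (m - k)"
    by simp
  moreover have "real (card {F\<in>?G. R \<subseteq> F}) = iso_count q \<nu> m (Suc k)" if "R \<in> ?C" for R
  proof -
    have "{F\<in>?G. R \<subseteq> F} = {F \<in> isotropics m. R \<subseteq> F}"
      using that by (auto simp: covers_within_def)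
    then show ?thesis
      using Suc.hyps(1)[of "Suc k" R] Suc.hyps(2) Suc.prems k covers_within_perp_isotropic that by auto
  qed
  ultimately have "real (card ?G) * qnum q (m - k) = qnum q (2 * (\<nu> - k)) * iso_count q \<nu> m (Suc k)"
    using C by simp
  also have "\<dots> = iso_count q \<nu> m k * qnum q (m - k)"
    using iso_count_rec[OF q_ge_0 k, of \<nu>] by (simp only: mult.commute)
  finally show ?case
    using k qnum_ge_1[of q "m - k"] by simp
qed

text \<open>A subspace that is not isotropic lies in no member, so the bound covers every
  \<open>S\<close>. The averaging arguments may therefore pass through arbitrary subspaces.\<close>

lemma card_family_containing_le:
  assumes "\<F> \<subseteq> isotropics m" "subspace S" "dim S \<le> m" "m \<le> \<nu>"
  shows "real (card {F \<in> \<F>. S \<subseteq> F}) \<le> iso_count q \<nu> m (dim S)"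
proof (cases "\<exists>F\<in>\<F>. S \<subseteq> F")
  case True
  then have "S \<in> isotropics (dim S)" using assms isotropics_subset by blast
  moreover have "card {F \<in> \<F>. S \<subseteq> F} \<le> card {F \<in> isotropics m. S \<subseteq> F}"
    using assms by (intro card_mono) auto
  ultimately show ?thesis using assms card_isotropics_containing by fastforce
next
  case False
  then have empty: "{F \<in> \<F>. S \<subseteq> F} = {}" by auto
  show ?thesis unfolding empty using assms iso_count_pos[of q m \<nu> "dim S"] by simp
qed

lemma zero_isotropic: "{0} \<in> isotropics 0"
  by (simp add: isotropics_def totally_isotropic_def)

lemma exists_isotropic:
  assumes "m \<le> \<nu>" shows "\<exists>M. M \<in> isotropics m"
proof (rule ccontr)
  assume "\<not> ?thesis"
  then have "isotropics m = {}" by auto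
  then show False
    using card_isotropics_containing[OF zero_isotropic, of m] iso_count_pos[of q m \<nu> 0] assms by simp
qed

section \<open>Triangles of covers, and maximality\<close>

text \<open>The sum is spanned by \<open>S1 \<inter> S2\<close> together with one vector of
  \<open>S1 \<inter> S3\<close> and one of \<open>S2 \<inter> S3\<close>. Any two of these
  generators lie in a common \<open>Si\<close>, hence are orthogonal.\<close>

lemma isotropic_triangle:
  assumes S: "S1 \<in> isotropics (t + 1)" "S2 \<in> isotropics (t + 1)" "S3 \<in> isotropics (t + 1)"
    and t: "t \<le> dim (S1 \<inter> S2)" "t \<le> dim (S1 \<inter> S3)" "t \<le> dim (S2 \<inter> S3)"
    and "S1 \<noteq> S2" and not: "\<not> S1 \<inter> S2 \<subseteq> S3"
  shows "S1 + S2 \<in> isotropics (t + 2)"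
    and "\<And>F. subspace F \<Longrightarrow> t \<le> dim (F \<inter> S1) \<Longrightarrow> t \<le> dim (F \<inter> S2) \<Longrightarrow> t \<le> dim (F \<inter> S3)
      \<Longrightarrow> t + 1 \<le> dim (F \<inter> (S1 + S2))"
proof -
  let ?T = "S1 \<inter> S2" and ?Z = "S1 + S2"
  have sub: "subspace S1" "subspace S2" "subspace S3" and dims: "dim S1 = t + 1" "dim S2 = t + 1" "dim S3 = t + 1"
    using S by (auto dest: isotropicsD)
  then have Z: "subspace ?Z" by (simp add: subspace_set_plus)
  have "dim ?T \<noteq> t + 1"
    using subspace_eqI[of ?T S1] subspace_eqI[of ?T S2] sub dims \<open>S1 \<noteq> S2\<close> by (auto simp: subspace_inter)
  moreover have "dim ?T \<le> t + 1" using dim_subset[of ?T S1] dims by simp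
  ultimately have T: "dim ?T = t" using t by simp
  have dimZ: "dim ?Z = t + 2" using dim_set_plus[OF sub(1,2)] T dims by simp
  have lt: "dim (?T \<inter> S3) < t"
    using dim_less[of "?T \<inter> S3" ?T] T sub not by (auto simp: subspace_inter)
  have "\<not> S1 \<inter> S3 \<subseteq> S2" "\<not> S2 \<inter> S3 \<subseteq> S1"
    using lt t dim_subset[of "S1 \<inter> S3" "?T \<inter> S3"] dim_subset[of "S2 \<inter> S3" "?T \<inter> S3"] by auto
  then obtain a b where a: "a \<in> S1" "a \<in> S3" "a \<notin> S2" and b: "b \<in> S2" "b \<in> S3" "b \<notin> S1" by blast
  let ?X = "insert a (insert b ?T)"
  have spanT: "span ?T = ?T" using sub by (simp add: subspace_inter)
  have "span (insert b ?T) \<subseteq> S2" using b sub by (intro span_minimal) auto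
  then have "a \<notin> span (insert b ?T)" "b \<notin> span ?T"
    using a b unfolding spanT by auto
  then have "dim ?X = t + 2" using T by (simp add: dim_insert)
  moreover have subX: "?X \<subseteq> ?Z" using a b sub subset_set_plus[of S1 S2] by auto
  ultimately have "span ?X = ?Z"
    using Z dimZ by (intro subspace_eqI span_minimal) auto
  moreover have "?X \<subseteq> perp ?X"
    using S a b by (auto simp: perp_def isotropics_def totally_isotropic_def alternating)
  ultimately have "totally_isotropic ?Z" using totally_isotropic_span[of ?X] by simp
  then show "?Z \<in> isotropics (t + 2)" using dimZ by (simp add: isotropics_def)
  have "dim ((S1 \<inter> S3) + (S2 \<inter> S3)) + dim (?T \<inter> S3) = dim (S1 \<inter> S3) + dim (S2 \<inter> S3)"
    using dim_set_plus[of "S1 \<inter> S3" "S2 \<inter> S3"] sub by (simp add: subspace_inter Int_ac)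
  then have "dim S3 \<le> dim ((S1 \<inter> S3) + (S2 \<inter> S3))" using lt t dims by linarith
  then have "(S1 \<inter> S3) + (S2 \<inter> S3) = S3"
    using sub by (intro subspace_eqI subspace_set_plus set_plus_subset) (auto simp: subspace_inter)
  then have S3: "S3 \<subseteq> ?Z" by (metis Int_lower1 set_plus_mono2)
  fix F assume F: "subspace F" "t \<le> dim (F \<inter> S1)" "t \<le> dim (F \<inter> S2)" "t \<le> dim (F \<inter> S3)"
  show "t + 1 \<le> dim (F \<inter> ?Z)"
  proof (rule ccontr)
    assume "\<not> ?thesis"
    then have le: "dim (F \<inter> ?Z) \<le> t" by simp
    \<comment> \<open>If \<open>F\<close> met the sum in dimension at most \<open>t\<close>, its
      three intersections would coincide and lie in \<open>S1 \<inter> S2 \<inter> S3\<close>, whose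
      dimension is below \<open>t\<close>.\<close>
    have "F \<inter> S1 = F \<inter> ?Z" "F \<inter> S2 = F \<inter> ?Z" "F \<inter> S3 = F \<inter> ?Z"
      using F le sub Z S3 subset_set_plus[of S1 S2] by (intro subspace_eqI; auto simp: subspace_inter)+
    then have "F \<inter> S1 \<subseteq> ?T \<inter> S3" by auto
    then show False using F(2) lt dim_subset[of "F \<inter> S1" "?T \<inter> S3"] by simp
  qed
qed

text \<open>Non-triviality passes to larger families, so a family containing \<open>\<F>\<close>
  competes with it as soon as it is \<open>t\<close>-intersecting.\<close>

lemma maximum_family_eq:
  assumes max: "maximum_nontrivial_t_intersecting m t \<F>"
    and "\<F> \<subseteq> \<G>" "\<G> \<subseteq> isotropics m" "t_intersecting t \<G>"
  shows "\<F> = \<G>"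
proof -
  have "\<not> trivial_family t \<G>"
    using max \<open>\<F> \<subseteq> \<G>\<close>
    unfolding maximum_nontrivial_t_intersecting_def nontrivial_t_intersecting_def trivial_family_def
    by blast
  then have "card \<G> \<le> card \<F>"
    using assms by (auto simp: maximum_nontrivial_t_intersecting_def nontrivial_t_intersecting_def)
  then show ?thesis
    using \<open>\<F> \<subseteq> \<G>\<close> by (intro card_seteq) auto
qed

lemma t_intersecting_H2:
  assumes Z: "subspace Z" "dim Z = t + 2" shows "t_intersecting t (H2 m t Z)"
  unfolding t_intersecting_def
proof (intro ballI)
  fix F G assume "F \<in> H2 m t Z" "G \<in> H2 m t Z"
  then have FG: "subspace F" "subspace G" "t + 1 \<le> dim (F \<inter> Z)" "t + 1 \<le> dim (G \<inter> Z)"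
    by (auto simp: H2_def dest: isotropicsD)
  have "dim ((F \<inter> Z) + (G \<inter> Z)) + dim ((F \<inter> Z) \<inter> (G \<inter> Z)) = dim (F \<inter> Z) + dim (G \<inter> Z)"
    using FG Z by (intro dim_set_plus subspace_inter)
  moreover have "dim ((F \<inter> Z) + (G \<inter> Z)) \<le> dim Z"
    using Z by (intro dim_subset set_plus_subset) auto
  moreover have "dim ((F \<inter> Z) \<inter> (G \<inter> Z)) \<le> dim (F \<inter> G)"
    by (intro dim_subset) auto
  ultimately show "t \<le> dim (F \<inter> G)" using FG Z by linarith
qed

section \<open>The sizes of the two extremal families\<close>

text \<open>Otherwise all \<open>qnum q (dim W)\<close> hyperplanes would contain the line of
  \<open>e\<close>, but only \<open>qnum q (dim W - 1)\<close> of them do. Dimension 1 is separate: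
  there \<open>{0}\<close> is the hyperplane.\<close>

lemma exists_hyperplane_avoiding:
  assumes W: "subspace W" and e: "e \<in> W" "e \<noteq> 0"
  shows "\<exists>H. subspace H \<and> H \<subseteq> W \<and> Suc (dim H) = dim W \<and> e \<notin> H"
proof (rule ccontr)
  assume no: "\<not> ?thesis"
  let ?E = "span {e}"
  have E: "?E \<subseteq> W" using assms by (intro span_minimal) auto
  have dimE: "dim ?E = 1" using e by simp
  then have "1 \<le> dim W" using dim_subset[OF E] by simp
  moreover have "dim W \<noteq> 1"
    using no e by (auto simp: subspace_0 W dest!: spec[of _ "{0}"])
  ultimately obtain n where n: "dim W = Suc (Suc n)"
    by (metis One_nat_def Suc_le_D not_less_eq_eq le_SucE le_antisym)
  have "{H. subspace H \<and> ?E \<subseteq> H \<and> H \<subseteq> W \<and> Suc (dim H) = dim W}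
      = {H. subspace H \<and> H \<subseteq> W \<and> Suc (dim H) = dim W}"
    using no span_minimal[of "{e}"] by auto
  then have "qnum q (Suc n) = qnum q (Suc (Suc n))"
    using card_hyperplanes_containing[of ?E W n] card_hyperplanes[OF W] E W dimE n by simp
  then show False using q_ge_2 by (simp add: qnum_Suc[of q "Suc n"])
qed

text \<open>The part of \<open>H1 m t T U\<close> that contains \<open>T\<close>, expressed through \<open>M = T + U\<close> alone.\<close>

definition star :: "nat \<Rightarrow> nat \<Rightarrow> 'v set \<Rightarrow> 'v set \<Rightarrow> 'v set set" where
  "star m t T M = {F \<in> isotropics m. T \<subseteq> F \<and> t + 1 \<le> dim (F \<inter> M)}"

text \<open>\<open>U\<close> is a hyperplane of \<open>M = T + U\<close>, so cutting
  \<open>F \<inter> M\<close> with \<open>U\<close> loses at most one dimension; conversely adding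
  \<open>T\<close>, which meets \<open>U\<close> in dimension \<open>t - 1\<close>, gains exactly
  one. In this form \<open>U\<close> enters only through \<open>M\<close>, so the extensions of
  \<open>T\<close> in \<open>M\<close> can be counted.\<close>

lemma H1_eq_star:
  assumes T: "T \<in> isotropics t" and U: "U \<in> isotropics m" and "dim (T \<inter> U) = t - 1" "1 \<le> t"
  shows "H1 m t T U = star m t T (T + U) \<union> isotropics_within m (T + U)"
proof -
  let ?M = "T + U"
  have sub: "subspace T" "subspace U" and dims: "dim T = t" "dim U = m"
    using T U by (auto dest: isotropicsD)
  have M: "subspace ?M" "T \<subseteq> ?M" "U \<subseteq> ?M" "dim ?M = m + 1"
    using sub dims dim_set_plus[OF sub] assms by (auto simp: subspace_set_plus subset_set_plus)
  have "t \<le> dim (F \<inter> U) \<longleftrightarrow> t + 1 \<le> dim (F \<inter> ?M)" if F: "subspace F" "T \<subseteq> F" for F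
  proof
    assume le: "t \<le> dim (F \<inter> U)"
    have "T \<inter> (F \<inter> U) = T \<inter> U" using F by auto
    then have "dim (T + (F \<inter> U)) + (t - 1) = t + dim (F \<inter> U)"
      using dim_set_plus[of T "F \<inter> U"] F sub assms dims by (simp add: subspace_inter)
    moreover have "dim (T + (F \<inter> U)) \<le> dim (F \<inter> ?M)"
      using F M by (intro dim_subset set_plus_subset subspace_inter) auto
    ultimately show "t + 1 \<le> dim (F \<inter> ?M)" using le assms by linarith
  next
    assume le: "t + 1 \<le> dim (F \<inter> ?M)"
    have "dim ((F \<inter> ?M) + U) + dim ((F \<inter> ?M) \<inter> U) = dim (F \<inter> ?M) + m"
      using dim_set_plus[of "F \<inter> ?M" U] F M sub dims by (simp add: subspace_inter)
    moreover have "dim ((F \<inter> ?M) + U) \<le> dim ?M"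
      using M by (intro dim_subset set_plus_subset) auto
    moreover have "(F \<inter> ?M) \<inter> U = F \<inter> U" using M by auto
    ultimately show "t \<le> dim (F \<inter> U)" using le M by simp
  qed
  then show ?thesis by (auto simp: H1_def star_def dest: isotropicsD)
qed

text \<open>Every member meets \<open>M = T + U\<close> in dimension at least \<open>t + 1\<close>,
  and a member inside \<open>M\<close> is a hyperplane of \<open>M\<close>. Two members not inside
  \<open>M\<close> share \<open>T\<close>.\<close>

lemma t_intersecting_H1:
  assumes T: "T \<in> isotropics t" and U: "U \<in> isotropics m" and "dim (T \<inter> U) = t - 1" "1 \<le> t" "t < m"
  shows "t_intersecting t (H1 m t T U)"
proof -
  let ?M = "T + U"
  have sub: "subspace T" "subspace U" and dims: "dim T = t" "dim U = m"
    using T U by (auto dest: isotropicsD)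
  have M: "subspace ?M" "dim ?M = m + 1"
    using sub dims dim_set_plus[OF sub] assms by (auto simp: subspace_set_plus)
  have within: "t \<le> dim (F \<inter> G)"
    if "subspace F" "t + 1 \<le> dim (F \<inter> ?M)" "G \<in> isotropics_within m ?M" for F G
  proof -
    have G: "subspace G" "dim G = m" "G \<subseteq> ?M"
      using that by (auto simp: isotropics_within_def dest: isotropicsD)
    have "dim ((F \<inter> ?M) + G) + dim ((F \<inter> ?M) \<inter> G) = dim (F \<inter> ?M) + m"
      using dim_set_plus[of "F \<inter> ?M" G] that G M by (simp add: subspace_inter)
    moreover have "dim ((F \<inter> ?M) + G) \<le> dim ?M"
      using M G by (intro dim_subset set_plus_subset) auto
    moreover have "(F \<inter> ?M) \<inter> G = F \<inter> G" using G by auto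
    ultimately show ?thesis using that M by simp
  qed
  have big: "subspace F \<and> t + 1 \<le> dim (F \<inter> ?M)" if "F \<in> H1 m t T U" for F
    using that assms unfolding H1_eq_star[OF assms(1-4)]
    by (auto simp: star_def isotropics_within_def Int_absorb2 dest: isotropicsD)
  show ?thesis
    unfolding t_intersecting_def
  proof (intro ballI)
    fix F G assume FG: "F \<in> H1 m t T U" "G \<in> H1 m t T U"
    show "t \<le> dim (F \<inter> G)"
    proof (cases "F \<in> isotropics_within m ?M \<or> G \<in> isotropics_within m ?M")
      case True
      then show ?thesis using within[of F G] within[of G F] big FG by (auto simp: Int_commute)
    next
      case False
      then have "T \<subseteq> F \<inter> G" using FG by (auto simp: H1_def)
      then show ?thesis using dim_subset[of T "F \<inter> G"] dims by simp
    qed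
  qed
qed

text \<open>Inside an isotropic \<open>M\<close> of dimension \<open>m + 1\<close>, a hyperplane
  \<open>U\<close> missing one vector of \<open>T\<close> satisfies \<open>T + U = M\<close>, which
  fixes the dimension of \<open>T \<inter> U\<close>.\<close>

lemma exists_H1_configuration:
  assumes "1 \<le> t" "t \<le> m" "m + 1 \<le> \<nu>"
  shows "\<exists>T\<in>isotropics t. \<exists>U\<in>isotropics m. T + U \<in> isotropics (m + 1) \<and> dim (T \<inter> U) = t - 1"
proof -
  obtain M where M: "M \<in> isotropics (m + 1)" using exists_isotropic assms by blast
  note D = isotropicsD[OF M]
  then obtain T where T: "subspace T" "T \<subseteq> span M" "dim T = t"
    using choose_subspace_of_subspace[of t M] assms by auto
  moreover have "span M = M" using D by simp
  ultimately have TM: "T \<subseteq> M" by simp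
  have "\<not> T \<subseteq> {0}" using T assms by (metis dim_eq_0 not_one_le_zero)
  then obtain e where e: "e \<in> T" "e \<noteq> 0" by auto
  then obtain U where U: "subspace U" "U \<subseteq> M" "Suc (dim U) = dim M" "e \<notin> U"
    using exists_hyperplane_avoiding[of M e] D TM by auto
  have "U \<subset> T + U" "T + U \<subseteq> M"
    using subset_set_plus[of T U] set_plus_subset[of M T U] T U e TM D by auto
  then have TU: "T + U = M"
    using dim_less[of U "T + U"] T U D by (intro subspace_eqI) (auto simp: subspace_set_plus)
  then have "dim (T \<inter> U) = t - 1" using dim_set_plus[of T U] T U D by simp
  moreover have "T \<in> isotropics t" "U \<in> isotropics m"
    using isotropics_subset[OF M T(1) TM] isotropics_subset[OF M U(1,2)] T U D by simp_all
  ultimately show ?thesis using TU M by blast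
qed

text \<open>All hyperplanes of the isotropic space \<open>T + U\<close> are members, and they have
  no common nonzero vector.\<close>

lemma nontrivial_H1:
  assumes "T \<in> isotropics t" "U \<in> isotropics m" and M: "T + U \<in> isotropics (m + 1)" and "1 \<le> t"
  shows "\<not> trivial_family t (H1 m t T U)"
proof
  assume "trivial_family t (H1 m t T U)"
  then obtain E where E: "dim E = t" "\<forall>F\<in>H1 m t T U. E \<subseteq> F" by (auto simp: trivial_family_def)
  note D = isotropicsD[OF M]
  have mem: "H \<in> H1 m t T U" if "subspace H" "H \<subseteq> T + U" "Suc (dim H) = dim (T + U)" for H
    using isotropics_subset[OF M that(1,2)] that D by (auto simp: H1_def isotropics_within_def)
  have "\<not> E \<subseteq> {0}" using E assms by (metis dim_eq_0 not_one_le_zero)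
  then obtain e where e: "e \<in> E" "e \<noteq> 0" by auto
  have "U \<subseteq> T + U" "U \<in> H1 m t T U"
    using assms subset_set_plus[of T U] mem[of U] D by (auto dest: isotropicsD)
  then have "e \<in> T + U" using E e by blast
  then show False
    using exists_hyperplane_avoiding[of "T + U" e] D e E mem by blast
qed

text \<open>With \<open>n = qnum q (d F)\<close> the number of extensions of \<open>T\<close> in
  \<open>F \<inter> M\<close>, the first sum counts pairs \<open>R \<subseteq> F\<close> and the
  second flags \<open>T < R < Q\<close> with \<open>Q \<subseteq> F \<inter> M\<close>. As
  \<open>n - 1 = q * qnum q (d F - 1)\<close>, \<open>q\<close> times the second sum is the sum of
  \<open>n (n - 1)\<close>.\<close>

lemma star_sums:
  assumes T: "T \<in> isotropics t" and M: "M \<in> isotropics (m + 1)" and "T \<subseteq> M" "t + 2 \<le> m"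
  defines "d \<equiv> \<lambda>F. dim (F \<inter> M) - t"
  shows "(\<Sum>F\<in>star m t T M. qnum q (d F)) = qnum q (m + 1 - t) * iso_count q \<nu> m (t + 1)"
    and "(\<Sum>F\<in>star m t T M. qnum q (d F) * qnum q (d F - 1))
      = qnum q (m + 1 - t) * qnum q (m - t) * iso_count q \<nu> m (t + 2)"
proof -
  let ?A = "star m t T M" and ?C = "covers_within T M"
  note DT = isotropicsD[OF T] and DM = isotropicsD[OF M]
  have C: "real (card ?C) = qnum q (m + 1 - t)"
    using card_covers_within[OF DT(1) DM(1) \<open>T \<subseteq> M\<close>] DT DM by simp
  have R: "R \<in> isotropics (t + 1)" "{F\<in>?A. R \<subseteq> F} = {F\<in>isotropics m. R \<subseteq> F}" if "R \<in> ?C" for R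
  proof -
    have R: "subspace R" "T \<subseteq> R" "R \<subseteq> M" "dim R = t + 1"
      using that DT by (auto simp: covers_within_def)
    show "R \<in> isotropics (t + 1)" using isotropics_subset[OF M R(1,3)] R by simp
    have "t + 1 \<le> dim (F \<inter> M)" if "R \<subseteq> F" for F
      using dim_subset[of R "F \<inter> M"] R that by simp
    then show "{F\<in>?A. R \<subseteq> F} = {F\<in>isotropics m. R \<subseteq> F}"
      using R by (auto simp: star_def)
  qed
  have X: "real (card {F\<in>?A. R \<subseteq> F}) = iso_count q \<nu> m (t + 1)" if "R \<in> ?C" for R
    unfolding R(2)[OF that] using R(1)[OF that] assms by (intro card_isotropics_containing) auto
  have "(\<Sum>R\<in>?C. real (card {F\<in>?A. R \<subseteq> F})) = (\<Sum>F\<in>?A. qnum q (dim (F \<inter> M) - dim T))"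
    using DT DM \<open>T \<subseteq> M\<close> by (intro sum_covers_within) (auto simp: star_def dest: isotropicsD)
  then show "(\<Sum>F\<in>?A. qnum q (d F)) = qnum q (m + 1 - t) * iso_count q \<nu> m (t + 1)"
    using X C DT by (simp add: d_def)
  have inner: "(\<Sum>F\<in>{F\<in>?A. R \<subseteq> F}. qnum q (d F - 1)) = qnum q (m - t) * iso_count q \<nu> m (t + 2)"
    if RC: "R \<in> ?C" for R
  proof -
    note DR = isotropicsD[OF R(1)[OF RC]]
    have RM: "R \<subseteq> M" using RC by (auto simp: covers_within_def)
    let ?B = "{F\<in>isotropics m. R \<subseteq> F}"
    have Y: "real (card {F\<in>?B. Q \<subseteq> F}) = iso_count q \<nu> m (t + 2)" if Q: "Q \<in> covers_within R M" for Q
    proof -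
      have "{F\<in>?B. Q \<subseteq> F} = {F\<in>isotropics m. Q \<subseteq> F}"
        using Q by (auto simp: covers_within_def)
      moreover have "Q \<in> isotropics (t + 2)"
        using isotropics_subset[OF M, of Q] Q DR by (auto simp: covers_within_def)
      ultimately show ?thesis using assms card_isotropics_containing[of Q "t + 2" m] by simp
    qed
    have "(\<Sum>Q\<in>covers_within R M. real (card {F\<in>?B. Q \<subseteq> F})) = (\<Sum>F\<in>?B. qnum q (dim (F \<inter> M) - dim R))"
      using DR DM RM by (intro sum_covers_within) (auto dest: isotropicsD)
    then show ?thesis
      using Y card_covers_within[OF DR(1) DM(1) RM] DR DM unfolding R(2)[OF RC] by (simp add: d_def)
  qed
  have "(\<Sum>F\<in>?A. qnum q (d F) * qnum q (d F - 1))
      = (\<Sum>F\<in>?A. \<Sum>R\<in>{R\<in>?C. R \<subseteq> F}. qnum q (d F - 1))"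
  proof (intro sum.cong refl)
    fix F assume "F \<in> ?A"
    then have "real (card (covers_within T (F \<inter> M))) = qnum q (d F)"
      using card_covers_within[of T "F \<inter> M"] DT DM \<open>T \<subseteq> M\<close>
      by (auto simp: star_def d_def subspace_inter dest: isotropicsD)
    then show "qnum q (d F) * qnum q (d F - 1) = (\<Sum>R\<in>{R\<in>?C. R \<subseteq> F}. qnum q (d F - 1))"
      by (simp add: covers_within_subset)
  qed
  also have "\<dots> = (\<Sum>R\<in>?C. \<Sum>F\<in>{F\<in>?A. R \<subseteq> F}. qnum q (d F - 1))"
    by (intro sum.swap_restrict) auto
  finally show "(\<Sum>F\<in>?A. qnum q (d F) * qnum q (d F - 1))
      = qnum q (m + 1 - t) * qnum q (m - t) * iso_count q \<nu> m (t + 2)"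
    using inner C by simp
qed

text \<open>Each member of the star contains \<open>n = qnum q d\<close> extensions of \<open>T\<close> in \<open>M\<close> for some \<open>d \<ge> 1\<close>. The lower
  bound is Bonferroni's inequality \<open>n - n (n - 1) / 2 \<le> 1\<close>; the upper bound uses
  \<open>n \<le> qnum q (m - t)\<close> in \<open>n (n - 1)\<close>.\<close>

lemma card_star_ge:
  assumes T: "T \<in> isotropics t" and M: "M \<in> isotropics (m + 1)" and "T \<subseteq> M" "t + 2 \<le> m" "m \<le> \<nu>"
  shows "qnum q (m + 1 - t) * iso_count q \<nu> m (t + 1)
    - (qnum q (m + 1 - t))\<^sup>2 * iso_count q \<nu> m (t + 2) / 2 \<le> real (card (star m t T M))"
proof -
  let ?A = "star m t T M" and ?d = "\<lambda>F. dim (F \<inter> M) - t" and ?Y = "iso_count q \<nu> m (t + 2)"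
  note sums = star_sums[OF assms(1-4)]
  have "real (card ?A) = (\<Sum>F\<in>?A. 1)" by simp
  also have "\<dots> \<ge> (\<Sum>F\<in>?A. qnum q (?d F) - q * (qnum q (?d F) * qnum q (?d F - 1)) / 2)"
  proof (rule sum_mono)
    fix F assume "F \<in> ?A"
    then obtain e where e: "?d F = Suc e"
      by (auto simp: star_def intro: that[of "dim (F \<inter> M) - t - 1"])
    let ?u = "q * qnum q e"
    \<comment> \<open>With \<open>?u = n - 1\<close> this is \<open>(n - 1) (n - 2) \<ge> 0\<close>,
      a rearrangement of the Bonferroni inequality.\<close>
    have "0 \<le> ?u * (?u - 1)"
    proof (cases e)
      case (Suc n)
      then have "2 * 1 \<le> ?u" using q_ge_2 qnum_ge_1[of q e] by (intro mult_mono) auto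
      then show ?thesis by simp
    qed simp
    then show "qnum q (?d F) - q * (qnum q (?d F) * qnum q (?d F - 1)) / 2 \<le> 1"
      unfolding e by (simp add: qnum_Suc_shift algebra_simps)
  qed
  also have "(\<Sum>F\<in>?A. qnum q (?d F) - q * (qnum q (?d F) * qnum q (?d F - 1)) / 2)
      = qnum q (m + 1 - t) * iso_count q \<nu> m (t + 1)
        - q * (qnum q (m + 1 - t) * qnum q (m - t) * ?Y) / 2"
    by (simp only: sum_subtractf sums flip: sum_divide_distrib sum_distrib_left)
  finally have "qnum q (m + 1 - t) * iso_count q \<nu> m (t + 1)
        - q * (qnum q (m + 1 - t) * qnum q (m - t) * ?Y) / 2 \<le> real (card ?A)" .
  moreover have "qnum q (m + 1 - t) * ?Y * (q * qnum q (m - t)) \<le> qnum q (m + 1 - t) * ?Y * qnum q (m + 1 - t)"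
    using assms iso_count_pos[of q m \<nu> "t + 2"] qnum_Suc_shift[of q "m - t"]
    by (intro mult_left_mono) (auto simp: qnum_nonneg Suc_diff_le)
  ultimately show ?thesis by (simp add: power2_eq_square mult_ac)
qed

lemma card_star_le:
  assumes T: "T \<in> isotropics t" and M: "M \<in> isotropics (m + 1)" and "T \<subseteq> M" "t + 2 \<le> m"
  shows "real (card (star m t T M)) \<le> qnum q (m + 1 - t) * iso_count q \<nu> m (t + 1)
    - q * qnum q (m + 1 - t) * iso_count q \<nu> m (t + 2)"
proof -
  let ?A = "star m t T M" and ?d = "\<lambda>F. dim (F \<inter> M) - t" and ?Y = "iso_count q \<nu> m (t + 2)"
  note sums = star_sums[OF assms(1-4)]
  have pos: "0 < qnum q (m - t)" using assms qnum_ge_1[of q "m - t"] by simp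
  have "q * (qnum q (m + 1 - t) * qnum q (m - t) * ?Y) = (\<Sum>F\<in>?A. q * (qnum q (?d F) * qnum q (?d F - 1)))"
    by (simp only: sums flip: sum_distrib_left)
  also have "\<dots> \<le> (\<Sum>F\<in>?A. qnum q (m - t) * (qnum q (?d F) - 1))"
  proof (rule sum_mono)
    fix F assume F: "F \<in> ?A"
    then obtain e where e: "?d F = Suc e"
      by (auto simp: star_def intro: that[of "dim (F \<inter> M) - t - 1"])
    \<comment> \<open>\<open>F\<close> has dimension \<open>m\<close> and so cannot contain all of
      \<open>M\<close>; this keeps \<open>n\<close> at most \<open>qnum q (m - t)\<close>.\<close>
    have "dim (F \<inter> M) \<le> m" using F dim_subset[of "F \<inter> M" F] by (auto simp: star_def dest: isotropicsD)
    then have "qnum q (Suc e) \<le> qnum q (m - t)" using e by (intro qnum_mono) auto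
    then have "(q * qnum q e) * qnum q (Suc e) \<le> (q * qnum q e) * qnum q (m - t)"
      by (intro mult_left_mono) (auto simp: qnum_nonneg)
    then show "q * (qnum q (?d F) * qnum q (?d F - 1)) \<le> qnum q (m - t) * (qnum q (?d F) - 1)"
      unfolding e by (simp add: qnum_Suc_shift algebra_simps)
  qed
  also have "\<dots> = qnum q (m - t) * (qnum q (m + 1 - t) * iso_count q \<nu> m (t + 1) - real (card ?A))"
    by (simp only: sum_subtractf sums flip: sum_distrib_left) simp
  finally have "qnum q (m - t) * (q * qnum q (m + 1 - t) * ?Y)
      \<le> qnum q (m - t) * (qnum q (m + 1 - t) * iso_count q \<nu> m (t + 1) - real (card ?A))"
    by (simp add: mult_ac)
  then show ?thesis using pos by simp
qed

lemma card_isotropics_within_le: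
  assumes "subspace M" "dim M = m + 1"
  shows "real (card (isotropics_within m M)) \<le> qnum q (m + 1)"
proof -
  have "card (isotropics_within m M) \<le> card {H. subspace H \<and> H \<subseteq> M \<and> Suc (dim H) = dim M}"
    using assms by (intro card_mono) (auto simp: isotropics_within_def dest: isotropicsD)
  then show ?thesis using card_hyperplanes[OF assms(1)] assms by simp
qed

lemma card_H2_le:
  assumes Z: "subspace Z" "dim Z = t + 2" and "t + 1 \<le> m" "m \<le> \<nu>"
  shows "real (card (H2 m t Z)) \<le> qnum q (t + 2) * iso_count q \<nu> m (t + 1)"
proof -
  have "\<exists>R. subspace R \<and> {0} \<subseteq> R \<and> R \<subseteq> Z \<and> dim R = dim {0} + (t + 1) \<and>
    real (card (H2 m t Z)) \<le> gauss_binomial q (t + 1) 1 * real (card {F\<in>H2 m t Z. R \<subseteq> F})"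
    using Z by (intro exists_subspace_averaging) (auto simp: H2_def subspace_0 dest: isotropicsD)
  then obtain R where R: "subspace R" "dim R = t + 1"
    and le: "real (card (H2 m t Z)) \<le> qnum q (t + 2) * real (card {F\<in>H2 m t Z. R \<subseteq> F})"
    by (auto simp: gauss_binomial_1[OF q_ge_0, of "Suc t", simplified])
  have "real (card {F\<in>H2 m t Z. R \<subseteq> F}) \<le> iso_count q \<nu> m (t + 1)"
    using card_family_containing_le[of "H2 m t Z" m R] R assms by (auto simp: H2_def)
  then show ?thesis
    using le mult_left_mono[of _ _ "qnum q (t + 2)"] by (fastforce simp: qnum_nonneg)
qed

text \<open>Count pairs of a hyperplane of \<open>Z\<close> and a member containing it. A member not
  containing \<open>Z\<close> occurs at most once, one containing \<open>Z\<close> occurs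
  \<open>qnum q (t + 2)\<close> times, and the correction term removes the surplus.\<close>

lemma card_H2_ge:
  assumes Z: "Z \<in> isotropics (t + 2)" and "t + 2 \<le> m"
  shows "qnum q (t + 2) * iso_count q \<nu> m (t + 1) - (qnum q (t + 2) - 1) * iso_count q \<nu> m (t + 2)
    \<le> real (card (H2 m t Z))"
proof -
  let ?A = "H2 m t Z" and ?H = "{H. subspace H \<and> H \<subseteq> Z \<and> Suc (dim H) = dim Z}"
  note D = isotropicsD[OF Z]
  have H: "real (card ?H) = qnum q (t + 2)" using card_hyperplanes[OF D(1)] D by simp
  have "real (card {F\<in>?A. S \<subseteq> F}) = iso_count q \<nu> m (t + 1)" if S: "S \<in> ?H" for S
  proof -
    have "t + 1 \<le> dim (F \<inter> Z)" if "S \<subseteq> F" for F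
      using dim_subset[of S "F \<inter> Z"] S D that by auto
    then have "{F\<in>?A. S \<subseteq> F} = {F\<in>isotropics m. S \<subseteq> F}" by (auto simp: H2_def)
    moreover have "S \<in> isotropics (t + 1)"
      using isotropics_subset[OF Z, of S] S D by simp
    ultimately show ?thesis using card_isotropics_containing[of S "t + 1" m] assms by simp
  qed
  then have "qnum q (t + 2) * iso_count q \<nu> m (t + 1) = (\<Sum>S\<in>?H. real (card {F\<in>?A. S \<subseteq> F}))"
    using H by simp
  also have "\<dots> = (\<Sum>F\<in>?A. real (card {S\<in>?H. S \<subseteq> F}))"
    using arg_cong[OF sum_card_containing, of real] by simp
  also have "\<dots> \<le> (\<Sum>F\<in>?A. 1 + (if Z \<subseteq> F then qnum q (t + 2) - 1 else 0))"
  proof (rule sum_mono)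
    fix F assume F: "F \<in> ?A"
    then have subF: "subspace (F \<inter> Z)" "t + 1 \<le> dim (F \<inter> Z)"
      using D by (auto simp: H2_def subspace_inter dest: isotropicsD)
    show "real (card {S\<in>?H. S \<subseteq> F}) \<le> 1 + (if Z \<subseteq> F then qnum q (t + 2) - 1 else 0)"
    proof (cases "Z \<subseteq> F")
      case True
      have "card {S\<in>?H. S \<subseteq> F} \<le> card ?H" by (intro card_mono) auto
      with True H show ?thesis by simp
    next
      case False
      then have "dim (F \<inter> Z) < t + 2" using dim_less[of "F \<inter> Z" Z] subF D by auto
      then have "S = F \<inter> Z" if "S \<in> ?H" "S \<subseteq> F" for S
        using that subF D by (intro subspace_eqI) auto
      then have "{S\<in>?H. S \<subseteq> F} \<subseteq> {F \<inter> Z}" by auto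
      then have "card {S\<in>?H. S \<subseteq> F} \<le> card {F \<inter> Z}" by (intro card_mono) auto
      with False show ?thesis by simp
    qed
  qed
  also have "\<dots> = real (card ?A) + (qnum q (t + 2) - 1) * real (card {F\<in>?A. Z \<subseteq> F})"
    by (simp add: sum.distrib sum.If_cases Int_def)
  also have "{F\<in>?A. Z \<subseteq> F} = {F\<in>isotropics m. Z \<subseteq> F}"
    using D by (auto simp: H2_def Int_absorb1)
  also have "real (card \<dots>) = iso_count q \<nu> m (t + 2)"
    using Z assms by (intro card_isotropics_containing) auto
  finally show ?thesis by linarith
qed

text \<open>If a hyperplane \<open>H\<close> of \<open>Z\<close> missed a vector \<open>e\<close> of
  a common subspace, all isotropic \<open>m\<close>-spaces through \<open>H\<close> would contain
  the larger \<open>span (insert e H)\<close>, contradicting the strict decrease of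
  \<open>iso_count\<close>. So the common subspace lies in every hyperplane of \<open>Z\<close>,
  which leaves only \<open>{0}\<close>.\<close>

lemma nontrivial_H2:
  assumes Z: "Z \<in> isotropics (t + 2)" and "1 \<le> t" "t + 2 \<le> m" "m + t + 2 \<le> 2 * \<nu>" "m \<le> \<nu>"
  shows "\<not> trivial_family t (H2 m t Z)"
proof
  assume "trivial_family t (H2 m t Z)"
  then obtain E where E: "dim E = t" "\<forall>F\<in>H2 m t Z. E \<subseteq> F" by (auto simp: trivial_family_def)
  note D = isotropicsD[OF Z]
  let ?X = "iso_count q \<nu> m (t + 1)" and ?Y = "iso_count q \<nu> m (t + 2)"
  have Y: "0 < ?Y" using assms by (intro iso_count_pos) auto
  have "2 * ?Y \<le> q * ?Y" using q_ge_2 Y by (intro mult_right_mono) auto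
  moreover have "q * ?Y \<le> ?X"
    using assms q_ge_2 iso_count_ge[of q m \<nu> "t + 1" 1] by simp
  ultimately have XY: "?Y < ?X" using Y by linarith
  have EH: "E \<subseteq> H" if H: "subspace H" "H \<subseteq> Z" "Suc (dim H) = dim Z" for H
  proof
    fix e assume e: "e \<in> E"
    have dimH: "dim H = t + 1" using H D by simp
    have "t + 1 \<le> dim (F \<inter> Z)" if "H \<subseteq> F" for F
      using dim_subset[of H "F \<inter> Z"] H dimH that by auto
    then have eF: "e \<in> F" if "F \<in> isotropics m" "H \<subseteq> F" for F
      using E e that by (auto simp: H2_def)
    show "e \<in> H"
    proof (rule ccontr)
      assume "e \<notin> H"
      let ?R = "span (insert e H)"
      have "e \<notin> span H" using \<open>e \<notin> H\<close> H span_minimal[of H H] by auto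
      then have R: "dim ?R = t + 2" using dimH by (simp add: dim_insert)
      have "{F\<in>isotropics m. H \<subseteq> F} \<subseteq> {F\<in>isotropics m. ?R \<subseteq> F}"
        using eF span_minimal[of "insert e H"] isotropicsD(1) by auto
      then have "real (card {F\<in>isotropics m. H \<subseteq> F}) \<le> real (card {F\<in>isotropics m. ?R \<subseteq> F})"
        by (simp add: card_mono)
      also have "\<dots> \<le> ?Y" using card_family_containing_le[of _ m ?R] R assms by simp
      finally show False
        using card_isotropics_containing[of H "t + 1" m] isotropics_subset[OF Z H(1,2)] dimH assms XY by simp
    qed
  qed
  have "\<not> E \<subseteq> {0}" using E assms by (metis dim_eq_0 not_one_le_zero)
  then obtain e where e: "e \<in> E" "e \<noteq> 0" by auto
  obtain H where H: "subspace H" "H \<subseteq> Z" "Suc (dim H) = dim Z"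
    using choose_subspace_of_subspace[of "t + 1" Z] D by (metis add_2_eq_Suc' le_add1 add_Suc_right Suc_eq_plus1 span_eq_iff le_SucI le_refl)
  then have "e \<in> Z" using EH e by blast
  then show False using exists_hyperplane_avoiding[of Z e] D e EH by blast
qed

section \<open>Covers\<close>

definition t_cover :: "nat \<Rightarrow> 'v set set \<Rightarrow> 'v set \<Rightarrow> bool" where
  "t_cover t \<F> S \<longleftrightarrow> subspace S \<and> (\<forall>F\<in>\<F>. t \<le> dim (S \<inter> F))"

text \<open>\<open>F'\<close> witnesses that \<open>S\<close> is no cover. A member through
  \<open>S\<close> meets \<open>F'\<close> in dimension at least \<open>t\<close>, hence reaches at
  least \<open>t - dim (S \<inter> F')\<close> dimensions beyond \<open>S\<close> inside
  \<open>S + F'\<close>, and averaging over extensions of \<open>S\<close> in that sum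
  applies.\<close>

lemma non_cover_step:
  assumes S: "subspace S" and F': "F' \<in> isotropics m" and less: "dim (S \<inter> F') < t" and "t \<le> m"
    and \<G>: "\<And>F. F \<in> \<G> \<Longrightarrow> subspace F \<and> S \<subseteq> F \<and> t \<le> dim (F \<inter> F')"
  shows "\<exists>R. subspace R \<and> S \<subseteq> R \<and> dim R = Suc (dim S) \<and>
    real (card \<G>) \<le> qnum q (m + 1 - t) * real (card {F\<in>\<G>. R \<subseteq> F})"
proof -
  let ?W = "S + F'" and ?r = "dim (S \<inter> F')"
  note D = isotropicsD[OF F']
  define k where "k = t - ?r"
  have W: "subspace ?W" "S \<subseteq> ?W" "F' \<subseteq> ?W" "dim ?W = dim S + (m - ?r)"
    using S D dim_set_plus[OF S D(1)] less \<open>t \<le> m\<close> by (auto simp: subspace_set_plus subset_set_plus)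
  have "\<exists>R\<in>covers_within S ?W. qnum q k * real (card \<G>) \<le> qnum q (m - ?r) * real (card {F\<in>\<G>. R \<subseteq> F})"
  proof (rule exists_cover_averaging)
    fix F assume "F \<in> \<G>"
    note F = \<G>[OF this]
    have "S \<inter> (F \<inter> F') = S \<inter> F'" using F by auto
    then have "dim (S + (F \<inter> F')) + ?r = dim S + dim (F \<inter> F')"
      using dim_set_plus[of S "F \<inter> F'"] S F D by (simp add: subspace_inter)
    moreover have "dim (S + (F \<inter> F')) \<le> dim (F \<inter> ?W)"
      using F W by (intro dim_subset set_plus_subset subspace_inter) auto
    ultimately show "subspace F \<and> S \<subseteq> F \<and> dim S + k \<le> dim (F \<inter> ?W)"
      using F less by (auto simp: k_def)
  qed (use S W less \<open>t \<le> m\<close> in \<open>auto simp: k_def\<close>)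
  then obtain R where R: "R \<in> covers_within S ?W"
    and le: "qnum q k * real (card \<G>) \<le> qnum q (m - ?r) * real (card {F\<in>\<G>. R \<subseteq> F})" by blast
  obtain j where j: "k = Suc j" using less by (cases k) (auto simp: k_def)
  then have "m - ?r = (m - t) + Suc j" "m + 1 - t = Suc (m - t)"
    using less \<open>t \<le> m\<close> by (auto simp: k_def)
  then have "qnum q (m - ?r) \<le> qnum q k * qnum q (m + 1 - t)"
    using qnum_add_le_mult[of q "m - t" j] j by simp
  then have "qnum q (m - ?r) * real (card {F\<in>\<G>. R \<subseteq> F})
      \<le> qnum q k * qnum q (m + 1 - t) * real (card {F\<in>\<G>. R \<subseteq> F})"
    by (intro mult_right_mono) auto
  with le have "qnum q k * real (card \<G>) \<le> qnum q k * (qnum q (m + 1 - t) * real (card {F\<in>\<G>. R \<subseteq> F}))"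
    by simp
  moreover have "0 < qnum q k" using qnum_ge_1[of q k] j by simp
  ultimately show ?thesis using R by (auto simp: covers_within_def)
qed

text \<open>No space of dimension below \<open>s + j\<close> is a cover, so the step can be taken
  \<open>j\<close> times.\<close>

lemma non_cover_iterate:
  assumes "\<F> \<subseteq> isotropics m" "t_intersecting t \<F>" "t \<le> m"
    and "\<And>S. t_cover t \<F> S \<Longrightarrow> s + j \<le> dim S"
    and "\<G> \<subseteq> \<F>" "subspace S" "dim S = s" "\<And>F. F \<in> \<G> \<Longrightarrow> S \<subseteq> F"
  shows "\<exists>R. subspace R \<and> S \<subseteq> R \<and> dim R = s + j \<and>
    real (card \<G>) \<le> qnum q (m + 1 - t) ^ j * real (card {F\<in>\<G>. R \<subseteq> F})"
  using assms(4-)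
proof (induction j arbitrary: s S \<G>)
  case 0
  then have "{F\<in>\<G>. S \<subseteq> F} = \<G>" by auto
  with 0 show ?case by (intro exI[of _ S]) auto
next
  case (Suc j)
  then have "\<not> t_cover t \<F> S" using Suc.prems(1)[of S] by auto
  then obtain F' where F': "F' \<in> \<F>" "dim (S \<inter> F') < t"
    using Suc.prems by (auto simp: t_cover_def)
  have "\<exists>R. subspace R \<and> S \<subseteq> R \<and> dim R = Suc (dim S) \<and>
    real (card \<G>) \<le> qnum q (m + 1 - t) * real (card {F\<in>\<G>. R \<subseteq> F})"
  proof (rule non_cover_step)
    show "F' \<in> isotropics m" using F' assms by auto
    show "subspace F \<and> S \<subseteq> F \<and> t \<le> dim (F \<inter> F')" if "F \<in> \<G>" for F
      using that Suc.prems F' assms by (auto simp: t_intersecting_def dest: isotropicsD)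
  qed (use F' Suc.prems assms in auto)
  then obtain R where R: "subspace R" "S \<subseteq> R" "dim R = Suc s"
    and le: "real (card \<G>) \<le> qnum q (m + 1 - t) * real (card {F\<in>\<G>. R \<subseteq> F})"
    using Suc.prems by auto
  let ?G = "{F\<in>\<G>. R \<subseteq> F}"
  have "\<exists>R'. subspace R' \<and> R \<subseteq> R' \<and> dim R' = Suc s + j \<and>
    real (card ?G) \<le> qnum q (m + 1 - t) ^ j * real (card {F\<in>?G. R' \<subseteq> F})"
    using R Suc.prems by (intro Suc.IH) auto
  then obtain R' where R': "subspace R'" "R \<subseteq> R'" "dim R' = Suc s + j"
    and le': "real (card ?G) \<le> qnum q (m + 1 - t) ^ j * real (card {F\<in>?G. R' \<subseteq> F})" by blast
  have eq: "{F\<in>?G. R' \<subseteq> F} = {F\<in>\<G>. R' \<subseteq> F}" using R' by auto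
  have "qnum q (m + 1 - t) * real (card ?G)
      \<le> qnum q (m + 1 - t) * (qnum q (m + 1 - t) ^ j * real (card {F\<in>\<G>. R' \<subseteq> F}))"
    using le' unfolding eq by (intro mult_left_mono) (auto simp: qnum_nonneg)
  with le R R' show ?case by (intro exI[of _ R']) (auto simp: mult_ac)
qed

text \<open>Every member contains a \<open>t\<close>-dimensional subspace of the cover, so the
  average runs over those subspaces.\<close>

lemma cover_averaging:
  assumes "\<F> \<subseteq> isotropics m" "t_cover t \<F> S" "dim S = t + j" "\<G> \<subseteq> \<F>"
  shows "\<exists>T. subspace T \<and> dim T = t \<and>
    real (card \<G>) \<le> gauss_binomial q t j * real (card {F\<in>\<G>. T \<subseteq> F})"
proof -
  have "\<exists>R. subspace R \<and> {0} \<subseteq> R \<and> R \<subseteq> S \<and> dim R = dim {0} + t \<and>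
    real (card \<G>) \<le> gauss_binomial q t j * real (card {F\<in>\<G>. R \<subseteq> F})"
  proof (rule exists_subspace_averaging)
    fix F assume "F \<in> \<G>"
    then have "subspace F" "t \<le> dim (S \<inter> F)"
      using assms by (auto simp: t_cover_def dest: isotropicsD)
    then show "subspace F \<and> {0} \<subseteq> F \<and> dim {0} + t \<le> dim (F \<inter> S)"
      by (auto simp: Int_commute subspace_0)
  qed (use assms in \<open>auto simp: t_cover_def subspace_0\<close>)
  then show ?thesis by auto
qed

lemma maximum_eq_H2_of_triangle:
  assumes max: "maximum_nontrivial_t_intersecting m t \<F>"
    and S: "S1 \<in> isotropics (t + 1)" "S2 \<in> isotropics (t + 1)" "S3 \<in> isotropics (t + 1)"
    and "t \<le> dim (S1 \<inter> S2)" "t \<le> dim (S1 \<inter> S3)" "t \<le> dim (S2 \<inter> S3)"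
    and "S1 \<noteq> S2" "\<not> S1 \<inter> S2 \<subseteq> S3"
    and covers: "t_cover t \<F> S1" "t_cover t \<F> S2" "t_cover t \<F> S3"
  shows "\<exists>Z\<in>isotropics (t + 2). \<F> = H2 m t Z"
proof -
  note triangle = isotropic_triangle[OF assms(2-9)]
  have \<F>: "\<F> \<subseteq> isotropics m"
    using max by (auto simp: maximum_nontrivial_t_intersecting_def nontrivial_t_intersecting_def)
  have "t + 1 \<le> dim (F \<inter> (S1 + S2))" if "F \<in> \<F>" for F
    using that \<F> covers by (intro triangle(2)) (auto simp: t_cover_def Int_commute dest: isotropicsD)
  then have "\<F> \<subseteq> H2 m t (S1 + S2)" using \<F> by (auto simp: H2_def)
  moreover have "t_intersecting t (H2 m t (S1 + S2))"
    using isotropicsD[OF triangle(1)] by (intro t_intersecting_H2)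
  ultimately have "\<F> = H2 m t (S1 + S2)"
    using max by (intro maximum_family_eq) (auto simp: H2_def)
  with triangle(1) show ?thesis by blast
qed

text \<open>Here the members are isotropic covers of dimension \<open>t + 1\<close>. Non-triviality
  is applied three times to find the triangle: for a first member, for a second one, and for a third
  one missing the intersection of the first two.\<close>

lemma maximum_eq_H2_codim_1:
  assumes max: "maximum_nontrivial_t_intersecting (t + 1) t \<F>" and "t \<le> \<nu>"
  shows "\<exists>Z\<in>isotropics (t + 2). \<F> = H2 (t + 1) t Z"
proof -
  have \<F>: "\<F> \<subseteq> isotropics (t + 1)" and int: "t_intersecting t \<F>" and nontriv: "\<not> trivial_family t \<F>"
    using max by (auto simp: maximum_nontrivial_t_intersecting_def nontrivial_t_intersecting_def)
  have avoid: "\<exists>F\<in>\<F>. \<not> E \<subseteq> F" if "subspace E" "dim E = t" for E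
    using nontriv that by (auto simp: trivial_family_def)
  obtain E where "E \<in> isotropics t" using exists_isotropic \<open>t \<le> \<nu>\<close> by blast
  then obtain F1 where F1: "F1 \<in> \<F>" using avoid[of E] by (auto dest: isotropicsD)
  then have D1: "subspace F1" "dim F1 = t + 1" using \<F> by (auto dest: isotropicsD)
  obtain E' where "subspace E'" "E' \<subseteq> span F1" "dim E' = t"
    using choose_subspace_of_subspace[of t F1] D1 by auto
  moreover have "span F1 = F1" using D1 by simp
  ultimately obtain F2 where F2: "F2 \<in> \<F>" "F1 \<noteq> F2" using avoid[of E'] by auto
  then have D2: "subspace F2" "dim F2 = t + 1" using \<F> by (auto dest: isotropicsD)
  have t: "t \<le> dim (F \<inter> G)" if "F \<in> \<F>" "G \<in> \<F>" for F G
    using int that by (auto simp: t_intersecting_def)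
  have "F1 \<inter> F2 \<noteq> F1" using subspace_eqI[of F1 F2] D1 D2 F2 by auto
  then have "dim (F1 \<inter> F2) < t + 1" using dim_less[of "F1 \<inter> F2" F1] D1 D2 by (auto simp: subspace_inter)
  then have "dim (F1 \<inter> F2) = t" using t[OF F1 F2(1)] by simp
  then obtain F3 where F3: "F3 \<in> \<F>" "\<not> F1 \<inter> F2 \<subseteq> F3"
    using avoid[of "F1 \<inter> F2"] D1 D2 by (auto simp: subspace_inter)
  have "t_cover t \<F> F" if "F \<in> \<F>" for F
    using that t \<F> by (auto simp: t_cover_def dest: isotropicsD)
  then show ?thesis
    using max F1 F2 F3 t \<F> by (intro maximum_eq_H2_of_triangle[of "t + 1" t \<F> F1 F2 F3]) auto
qed

end

section \<open>The maximum family when \<open>m\<close> is at least \<open>t + 2\<close>\<close>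

locale maximum_family = symplectic_counting scale f \<nu> Basis q
  for scale :: "'k::{field,finite} \<Rightarrow> 'v::ab_group_add \<Rightarrow> 'v" (infixr \<open>*s\<close> 75)
    and f :: "'v \<Rightarrow> 'v \<Rightarrow> 'k" and \<nu> :: nat and Basis :: "'v set" and q :: real +
  fixes m t :: nat and \<F> :: "'v set set"
  assumes t_ge_1: "1 \<le> t" and t_le: "t + 2 \<le> m"
    and \<nu>_ge: "3 * m + 2 \<le> 2 * \<nu>" "2 * m + 2 * t + 6 \<le> 2 * \<nu>"
    and maximum: "maximum_nontrivial_t_intersecting m t \<F>"
begin

definition N :: "nat \<Rightarrow> real" where
  "N k = iso_count q \<nu> m k"

lemma m_le_\<nu>: "m + 1 \<le> \<nu>"
  using \<nu>_ge by linarith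

lemma N_ge_1: "1 \<le> N k"
  using m_le_\<nu> by (simp add: N_def iso_count_ge_1)

lemma N_Suc_le: "k < m \<Longrightarrow> m + k + e \<le> 2 * \<nu> \<Longrightarrow> q ^ e * N (Suc k) \<le> N k"
  using m_le_\<nu> q_ge_2 by (simp add: N_def iso_count_ge)

text \<open>The exponent is the guaranteed part of \<open>2 * \<nu> - m - (t + 1)\<close>, read off
  from \<open>2 * m + 2 * t + 6 \<le> 2 * \<nu>\<close>.\<close>

lemma N_gap: "q ^ (m + t + 5) * N (t + 2) \<le> N (t + 1)"
  using N_Suc_le[of "t + 1" "m + t + 5"] t_le \<nu>_ge by simp

lemma family_isotropics: "\<F> \<subseteq> isotropics m"
  and family_intersecting: "t_intersecting t \<F>"
  and family_nontrivial: "\<not> trivial_family t \<F>"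
  and family_maximum: "\<And>\<G>. nontrivial_t_intersecting m t \<G> \<Longrightarrow> card \<G> \<le> card \<F>"
  using maximum by (auto simp: maximum_nontrivial_t_intersecting_def nontrivial_t_intersecting_def)

lemma card_containing_le:
  "\<G> \<subseteq> isotropics m \<Longrightarrow> subspace S \<Longrightarrow> dim S \<le> m \<Longrightarrow> real (card {F \<in> \<G>. S \<subseteq> F}) \<le> N (dim S)"
  using card_family_containing_le m_le_\<nu> by (simp add: N_def)

lemma power_q_5: "32 \<le> q ^ 5"
  using power_mono[of 2 q 5] q_ge_2 by simp

lemma qnum_bounds: "qnum q (m + 1 - t) \<le> 2 * q ^ (m - t)" "qnum q (t + 1) \<le> 2 * q ^ t"
  "qnum q (m + 1 - t) = qnum q (m - t) + q ^ (m - t)"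
proof -
  have eq: "m + 1 - t = Suc (m - t)" using t_le by simp
  show "qnum q (m + 1 - t) \<le> 2 * q ^ (m - t)" "qnum q (t + 1) \<le> 2 * q ^ t"
    using qnum_Suc_le[OF q_ge_2, of "m - t"] qnum_Suc_le[OF q_ge_2, of t] by (simp_all only: eq Suc_eq_plus1)
  show "qnum q (m + 1 - t) = qnum q (m - t) + q ^ (m - t)" by (simp only: eq qnum_Suc)
qed

text \<open>The lower bound comes from comparison with some \<open>H1\<close>. The second summand is
  the later bound on the members avoiding all covers, so subtracting it leaves more than
  \<open>qnum q (m - t) * N (t + 1)\<close>.\<close>

lemma card_family_gt:
  "qnum q (m - t) * N (t + 1) + qnum q (t + 1) * (qnum q (m + 1 - t))\<^sup>2 * N (t + 2) < real (card \<F>)"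
proof -
  let ?p = "q ^ (m - t)" and ?a = "qnum q (m + 1 - t)" and ?X = "N (t + 1)" and ?Y = "N (t + 2)"
  obtain T U where TU: "T \<in> isotropics t" "U \<in> isotropics m" "T + U \<in> isotropics (m + 1)" "dim (T \<inter> U) = t - 1"
    using exists_H1_configuration[of t m] t_ge_1 t_le m_le_\<nu> by auto
  note D = isotropicsD[OF TU(1)] isotropicsD[OF TU(2)]
  have "nontrivial_t_intersecting m t (H1 m t T U)"
    using nontrivial_H1[OF TU(1-3) t_ge_1] t_intersecting_H1[OF TU(1,2,4) t_ge_1] t_le
    by (auto simp: nontrivial_t_intersecting_def H1_def isotropics_within_def)
  then have "card (H1 m t T U) \<le> card \<F>" by (rule family_maximum)
  moreover have "card (star m t T (T + U)) \<le> card (H1 m t T U)"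
    unfolding H1_eq_star[OF TU(1,2,4) t_ge_1] by (intro card_mono) auto
  moreover have "?a * ?X - ?a\<^sup>2 * ?Y / 2 \<le> real (card (star m t T (T + U)))"
    using card_star_ge[OF TU(1,3), folded N_def] t_le m_le_\<nu> subset_set_plus[of T U] D by simp
  ultimately have lower: "?a * ?X - ?a\<^sup>2 * ?Y / 2 \<le> real (card \<F>)" by linarith
  have Y: "1 \<le> ?Y" by (rule N_ge_1)
  have p: "1 \<le> q ^ n" for n using q_ge_2 by simp
  \<comment> \<open>The \<open>1 / 2\<close> is the Bonferroni loss in \<open>card_star_ge\<close>,
    added to the error term that has to be absorbed.\<close>
  have "qnum q (t + 1) + 1 / 2 \<le> 3 * q ^ t" using qnum_bounds(2) p[of t] by linarith
  moreover have "?a\<^sup>2 \<le> (2 * ?p)\<^sup>2" using qnum_bounds(1) by (intro power_mono) (auto simp: qnum_nonneg)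
  ultimately have "(qnum q (t + 1) + 1 / 2) * ?a\<^sup>2 \<le> (3 * q ^ t) * (2 * ?p)\<^sup>2"
    by (intro mult_mono) (auto simp: qnum_nonneg)
  also have "\<dots> = 12 * (?p * (?p * q ^ t))" by (simp add: power2_eq_square)
  finally have "(qnum q (t + 1) + 1 / 2) * ?a\<^sup>2 * ?Y \<le> 12 * (?p * (?p * q ^ t)) * ?Y"
    using Y by (intro mult_right_mono) auto
  \<comment> \<open>The accumulated constant 12 stays below \<open>32 \<le> q ^ 5\<close>, which is
    where the 5 in the exponent of \<open>N_gap\<close> is spent.\<close>
  also have "\<dots> < 32 * (?p * (?p * q ^ t)) * ?Y"
    using Y p[of "m - t"] p[of t] by simp
  also have "\<dots> \<le> q ^ 5 * q ^ t * (?p * (?p * q ^ t)) * ?Y"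
  proof -
    have "32 * 1 \<le> q ^ 5 * q ^ t" using power_q_5 p[of t] by (intro mult_mono) auto
    then show ?thesis using Y by (intro mult_right_mono) auto
  qed
  also have "\<dots> = ?p * (q ^ (m + t + 5) * ?Y)"
  proof -
    have eq: "m + t + 5 = 5 + t + (m - t) + t" using t_le by simp
    show ?thesis unfolding eq power_add by (simp only: mult_ac)
  qed
  also have "\<dots> \<le> ?p * ?X" using N_gap by (intro mult_left_mono) auto
  finally have "qnum q (t + 1) * ?a\<^sup>2 * ?Y + ?a\<^sup>2 * ?Y / 2 < ?p * ?X"
    by (simp add: algebra_simps)
  moreover have "?a * ?X = qnum q (m - t) * ?X + ?p * ?X"
    by (simp only: qnum_bounds(3) distrib_right)
  ultimately show ?thesis using lower by linarith
qed

lemma family_nonempty: "\<F> \<noteq> {}"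
proof
  assume empty: "\<F> = {}"
  obtain E where "E \<in> isotropics t" using exists_isotropic[of t] t_le m_le_\<nu> by auto
  then have "trivial_family t \<F>"
    unfolding empty trivial_family_def using isotropicsD by blast
  then show False using family_nontrivial by simp
qed

text \<open>A cover of dimension at most \<open>t\<close> would be contained in every member and
  make the family trivial.\<close>

lemma t_cover_dim_ge:
  assumes "t_cover t \<F> S" shows "t + 1 \<le> dim S"
proof (rule ccontr)
  assume "\<not> ?thesis"
  then have le: "dim S \<le> t" by simp
  obtain F0 where F0: "F0 \<in> \<F>" using family_nonempty by blast
  have sub: "subspace S" and ge: "t \<le> dim (S \<inter> F)" if "F \<in> \<F>" for F
    using assms that by (auto simp: t_cover_def)
  have "dim S = t" using ge[OF F0] dim_subset[of "S \<inter> F0" S] le by simp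
  moreover have "S \<subseteq> F" if "F \<in> \<F>" for F
  proof -
    have "subspace F" using family_isotropics that isotropicsD by auto
    then have "S \<inter> F = S"
      using ge[OF that] sub[OF that] le by (intro subspace_eqI subspace_inter) auto
    then show ?thesis by auto
  qed
  ultimately show False
    using family_nontrivial sub[OF F0] unfolding trivial_family_def by blast
qed

text \<open>The bound for families whose smallest covers have dimension \<open>t + j\<close> decreases in \<open>j\<close>; this is where
  \<open>3 m + 2 \<le> 2 \<nu>\<close> is needed.\<close>

lemma large_cover_bound:
  assumes "2 \<le> j" "t + j \<le> m"
  shows "(4 * q ^ m) ^ j * N (t + j) \<le> qnum q (m - t) * N (t + 1)"
  using assms
proof (induction j rule: dec_induct)
  case base
  have "(4 * q ^ m)\<^sup>2 * N (t + 2) \<le> q ^ (2 * m + 4) * N (t + 2)"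
  proof (intro mult_right_mono)
    have "16 \<le> q ^ 4" using power_mono[of 2 q 4] q_ge_2 by simp
    then have "16 * (q ^ m)\<^sup>2 \<le> q ^ 4 * (q ^ m)\<^sup>2" by (intro mult_right_mono) auto
    then show "(4 * q ^ m)\<^sup>2 \<le> q ^ (2 * m + 4)"
      by (simp add: power_mult_distrib power_add power_mult mult_ac power2_eq_square)
  qed (use N_ge_1[of "t + 2"] in auto)
  \<comment> \<open>The split isolates the power absorbed by \<open>N_gap\<close>; what remains is
    the leading term of \<open>qnum q (m - t)\<close>.\<close>
  also have "2 * m + 4 = (m - t - 1) + (m + t + 5)" using t_le by simp
  also have "q ^ ((m - t - 1) + (m + t + 5)) * N (t + 2) = q ^ (m - t - 1) * (q ^ (m + t + 5) * N (t + 2))"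
    by (simp only: power_add mult.assoc)
  also have "\<dots> \<le> q ^ (m - t - 1) * N (t + 1)"
    using N_gap by (intro mult_left_mono) auto
  also have "\<dots> \<le> qnum q (m - t) * N (t + 1)"
    using qnum_Suc_ge_power[of q "m - t - 1"] t_le N_ge_1[of "t + 1"]
    by (intro mult_right_mono) (auto simp: Suc_diff_Suc)
  finally show ?case .
next
  case (step j)
  have "4 * q ^ m * N (Suc (t + j)) \<le> q ^ (m + 2) * N (Suc (t + j))"
  proof (intro mult_right_mono)
    have "4 \<le> q ^ 2" using power_mono[of 2 q 2] q_ge_2 by simp
    then have "4 * q ^ m \<le> q ^ 2 * q ^ m" by (intro mult_right_mono) auto
    then show "4 * q ^ m \<le> q ^ (m + 2)" by (simp add: power_add power2_eq_square mult_ac)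
  qed (use N_ge_1[of "Suc (t + j)"] in auto)
  \<comment> \<open>The exponent condition \<open>m + (t + j) + (m + 2) \<le> 2 * \<nu>\<close>
    follows from \<open>t + j < m\<close> and \<open>3 * m + 2 \<le> 2 * \<nu>\<close>.\<close>
  also have "\<dots> \<le> N (t + j)" using step \<nu>_ge by (intro N_Suc_le) auto
  finally have "(4 * q ^ m) ^ j * (4 * q ^ m * N (Suc (t + j))) \<le> (4 * q ^ m) ^ j * N (t + j)"
    by (intro mult_left_mono) auto
  then show ?case using step by (simp add: mult_ac)
qed

text \<open>If the least cover dimension were \<open>t + j\<close> with \<open>j \<ge> 2\<close>,
  choosing a \<open>t\<close>-space in such a cover costs at most \<open>(2 * q ^ t) ^ j\<close>,
  and growing it back to dimension \<open>t + j\<close> costs at most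
  \<open>(2 * q ^ (m - t)) ^ j\<close>. The product \<open>(4 * q ^ m) ^ j\<close> explains the form
  of \<open>large_cover_bound\<close>.\<close>

lemma exists_small_cover: "\<exists>S. t_cover t \<F> S \<and> dim S = t + 1"
proof (rule ccontr)
  assume no: "\<not> ?thesis"
  define \<tau> where "\<tau> = (LEAST k. \<exists>S. t_cover t \<F> S \<and> dim S = k)"
  obtain F0 where F0: "F0 \<in> \<F>" using family_nonempty by blast
  then have cov0: "t_cover t \<F> F0" "dim F0 = m"
    using family_intersecting family_isotropics by (auto simp: t_cover_def t_intersecting_def dest: isotropicsD)
  then obtain S where S: "t_cover t \<F> S" "dim S = \<tau>"
    unfolding \<tau>_def using LeastI_ex[of "\<lambda>k. \<exists>S. t_cover t \<F> S \<and> dim S = k"] by blast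
  have least: "\<tau> \<le> dim S'" if "t_cover t \<F> S'" for S'
    unfolding \<tau>_def using that by (intro Least_le) auto
  have "\<tau> \<le> m" using least[OF cov0(1)] cov0 by simp
  moreover have "t + 2 \<le> \<tau>" using t_cover_dim_ge[OF S(1)] S no by (metis Suc_1 add_Suc_right add.right_neutral le_Suc_eq not_less_eq_eq One_nat_def)
  ultimately obtain j where j: "\<tau> = t + j" "2 \<le> j" "t + j \<le> m"
    using le_Suc_ex[of t \<tau>] by auto
  obtain T where T: "subspace T" "dim T = t"
    and le1: "real (card \<F>) \<le> gauss_binomial q t j * real (card {F\<in>\<F>. T \<subseteq> F})"
    using cover_averaging[OF family_isotropics S(1), of j \<F>] S j by auto
  have "\<exists>R. subspace R \<and> T \<subseteq> R \<and> dim R = t + j \<and>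
    real (card {F\<in>\<F>. T \<subseteq> F}) \<le> qnum q (m + 1 - t) ^ j * real (card {F\<in>{F\<in>\<F>. T \<subseteq> F}. R \<subseteq> F})"
    using least j T t_le family_isotropics family_intersecting
    by (intro non_cover_iterate[of \<F>]) auto
  then obtain R where R: "subspace R" "dim R = t + j"
    and le2: "real (card {F\<in>\<F>. T \<subseteq> F}) \<le> qnum q (m + 1 - t) ^ j * real (card {F\<in>{F\<in>\<F>. T \<subseteq> F}. R \<subseteq> F})"
    by blast
  have le3: "real (card {F\<in>{F\<in>\<F>. T \<subseteq> F}. R \<subseteq> F}) \<le> N (t + j)"
    using card_containing_le[of "{F\<in>\<F>. T \<subseteq> F}" R] R j family_isotropics by auto
  have "real (card {F\<in>\<F>. T \<subseteq> F}) \<le> qnum q (m + 1 - t) ^ j * N (t + j)"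
    using le2 le3 mult_left_mono[OF le3, of "qnum q (m + 1 - t) ^ j"] by (simp add: qnum_nonneg)
  also have "\<dots> \<le> (2 * q ^ (m - t)) ^ j * N (t + j)"
    using qnum_bounds(1) N_ge_1[of "t + j"] by (intro mult_right_mono power_mono) (auto simp: qnum_nonneg)
  finally have "gauss_binomial q t j * real (card {F\<in>\<F>. T \<subseteq> F})
      \<le> (2 * q ^ t) ^ j * ((2 * q ^ (m - t)) ^ j * N (t + j))"
    using gauss_binomial_le[OF q_ge_2, of t j] by (intro mult_mono) auto
  also have "\<dots> = ((2 * q ^ t) * (2 * q ^ (m - t))) ^ j * N (t + j)"
    by (simp only: power_mult_distrib mult.assoc)
  also have "(2 * q ^ t) * (2 * q ^ (m - t)) = 4 * q ^ m"
    using t_le by (simp flip: power_add)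
  also have "(4 * q ^ m) ^ j * N (t + j) \<le> qnum q (m - t) * N (t + 1)"
    using j by (intro large_cover_bound)
  finally have "real (card \<F>) \<le> qnum q (m - t) * N (t + 1)" using le1 by linarith
  moreover have "0 \<le> qnum q (t + 1) * (qnum q (m + 1 - t))\<^sup>2 * N (t + 2)"
    using N_ge_1[of "t + 2"] by (simp add: qnum_nonneg)
  ultimately show False using card_family_gt by linarith
qed

section \<open>Isotropic covers of dimension \<open>t + 1\<close>\<close>

definition \<C> :: "'v set set" where
  "\<C> = {S \<in> isotropics (t + 1). t_cover t \<F> S}"

text \<open>Averaging over a small cover, which may fail to be isotropic, gives a
  \<open>t\<close>-space \<open>T\<close>; no \<open>t\<close>-space is a cover, so one step leads
  to \<open>R\<close> of dimension \<open>t + 1\<close>. If \<open>R\<close> is a cover, no member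
  of \<open>\<G>\<close> contains it, since such a member would make \<open>R\<close> isotropic and
  put it into \<open>\<C>\<close>. Otherwise a second step reaches dimension
  \<open>t + 2\<close>.\<close>

lemma card_avoiding_le:
  assumes \<G>: "\<G> \<subseteq> \<F>" "\<And>F S. F \<in> \<G> \<Longrightarrow> S \<in> \<C> \<Longrightarrow> \<not> S \<subseteq> F"
  shows "real (card \<G>) \<le> qnum q (t + 1) * (qnum q (m + 1 - t))\<^sup>2 * N (t + 2)"
proof -
  let ?a = "qnum q (m + 1 - t)"
  obtain S where S: "t_cover t \<F> S" "dim S = t + 1" using exists_small_cover by blast
  obtain T where T: "subspace T" "dim T = t"
    and le1: "real (card \<G>) \<le> gauss_binomial q t 1 * real (card {F\<in>\<G>. T \<subseteq> F})"
    using cover_averaging[OF family_isotropics S \<G>(1)] by auto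
  have step: "\<exists>R. subspace R \<and> T \<subseteq> R \<and> dim R = t + 1 \<and>
    real (card {F\<in>\<G>. T \<subseteq> F}) \<le> ?a ^ 1 * real (card {F\<in>{F\<in>\<G>. T \<subseteq> F}. R \<subseteq> F})"
    using t_cover_dim_ge T t_le family_isotropics family_intersecting \<G>
    by (intro non_cover_iterate[of \<F>]) auto
  then obtain R where R: "subspace R" "T \<subseteq> R" "dim R = t + 1"
    and le2: "real (card {F\<in>\<G>. T \<subseteq> F}) \<le> ?a * real (card {F\<in>\<G>. R \<subseteq> F})"
  proof -
    from step obtain R where R: "subspace R" "T \<subseteq> R" "dim R = t + 1"
      and le: "real (card {F\<in>\<G>. T \<subseteq> F}) \<le> ?a * real (card {F\<in>{F\<in>\<G>. T \<subseteq> F}. R \<subseteq> F})" by auto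
    moreover have "{F\<in>{F\<in>\<G>. T \<subseteq> F}. R \<subseteq> F} = {F\<in>\<G>. R \<subseteq> F}" using R by auto
    ultimately show ?thesis using that by simp
  qed
  have le3: "real (card {F\<in>\<G>. R \<subseteq> F}) \<le> ?a * N (t + 2)"
  proof (cases "t_cover t \<F> R")
    case True
    have empty: "{F\<in>\<G>. R \<subseteq> F} = {}"
    proof (rule ccontr)
      assume "{F\<in>\<G>. R \<subseteq> F} \<noteq> {}"
      then obtain F where F: "F \<in> \<G>" "R \<subseteq> F" by auto
      then have "F \<in> isotropics m" using \<G> family_isotropics by auto
      then have "R \<in> \<C>" using isotropics_subset[of F m R] F R True by (simp add: \<C>_def)
      then show False using \<G> F by blast
    qed
    show ?thesis unfolding empty using N_ge_1[of "t + 2"] by (simp add: qnum_nonneg)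
  next
    case False
    then obtain F' where F': "F' \<in> \<F>" "dim (R \<inter> F') < t" using R by (auto simp: t_cover_def)
    have "\<exists>Q. subspace Q \<and> R \<subseteq> Q \<and> dim Q = Suc (dim R) \<and>
      real (card {F\<in>\<G>. R \<subseteq> F}) \<le> ?a * real (card {F\<in>{F\<in>\<G>. R \<subseteq> F}. Q \<subseteq> F})"
    proof (rule non_cover_step)
      show "F' \<in> isotropics m" using F' family_isotropics by auto
      show "subspace F \<and> R \<subseteq> F \<and> t \<le> dim (F \<inter> F')" if "F \<in> {F\<in>\<G>. R \<subseteq> F}" for F
        using that \<G> F' family_isotropics family_intersecting
        by (auto simp: t_intersecting_def dest: isotropicsD)
    qed (use R F' t_le in auto)
    then obtain Q where Q: "subspace Q" "dim Q = t + 2"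
      and le: "real (card {F\<in>\<G>. R \<subseteq> F}) \<le> ?a * real (card {F\<in>{F\<in>\<G>. R \<subseteq> F}. Q \<subseteq> F})"
      using R by auto
    have "real (card {F\<in>{F\<in>\<G>. R \<subseteq> F}. Q \<subseteq> F}) \<le> N (t + 2)"
      using card_containing_le[of "{F\<in>\<G>. R \<subseteq> F}" Q] Q t_le family_isotropics \<G> by auto
    then have "?a * real (card {F\<in>{F\<in>\<G>. R \<subseteq> F}. Q \<subseteq> F}) \<le> ?a * N (t + 2)"
      by (intro mult_left_mono) (auto simp: qnum_nonneg)
    with le show ?thesis by linarith
  qed
  have "real (card \<G>) \<le> qnum q (t + 1) * real (card {F\<in>\<G>. T \<subseteq> F})"
    using le1 by (simp only: gauss_binomial_1[OF q_ge_0] Suc_eq_plus1)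
  also have "\<dots> \<le> qnum q (t + 1) * (?a * (?a * N (t + 2)))"
    using le2 mult_left_mono[OF le3, of ?a] by (intro mult_left_mono) (auto simp: qnum_nonneg)
  finally show ?thesis by (simp add: power2_eq_square mult_ac)
qed

lemma card_\<C>_gt: "qnum q (m - t) < real (card \<C>)"
proof -
  let ?G = "{F\<in>\<F>. \<forall>S\<in>\<C>. \<not> S \<subseteq> F}"
  have "\<F> \<subseteq> ?G \<union> (\<Union>S\<in>\<C>. {F\<in>\<F>. S \<subseteq> F})" by auto
  then have "card \<F> \<le> card (?G \<union> (\<Union>S\<in>\<C>. {F\<in>\<F>. S \<subseteq> F}))" by (intro card_mono) auto
  also have "\<dots> \<le> card ?G + card (\<Union>S\<in>\<C>. {F\<in>\<F>. S \<subseteq> F})" by (rule card_Un_le)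
  also have "\<dots> \<le> card ?G + (\<Sum>S\<in>\<C>. card {F\<in>\<F>. S \<subseteq> F})"
    by (intro add_left_mono card_UN_le) auto
  finally have "real (card \<F>) \<le> real (card ?G) + (\<Sum>S\<in>\<C>. real (card {F\<in>\<F>. S \<subseteq> F}))"
    by (simp only: flip: of_nat_sum of_nat_add)
  also have "(\<Sum>S\<in>\<C>. real (card {F\<in>\<F>. S \<subseteq> F})) \<le> (\<Sum>S\<in>\<C>. N (t + 1))"
  proof (rule sum_mono)
    fix S assume "S \<in> \<C>"
    then have "subspace S" "dim S = t + 1" by (auto simp: \<C>_def dest: isotropicsD)
    then show "real (card {F\<in>\<F>. S \<subseteq> F}) \<le> N (t + 1)"
      using card_containing_le[OF family_isotropics, of S] t_le by simp
  qed
  also have "real (card ?G) \<le> qnum q (t + 1) * (qnum q (m + 1 - t))\<^sup>2 * N (t + 2)"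
    by (intro card_avoiding_le) auto
  finally have "qnum q (m - t) * N (t + 1) < real (card \<C>) * N (t + 1)"
    using card_family_gt by simp
  then show ?thesis using N_ge_1[of "t + 1"] by simp
qed

lemma containing_cover_in_family:
  assumes S: "t_cover t \<F> S" and F: "F \<in> isotropics m" "S \<subseteq> F"
  shows "F \<in> \<F>"
proof -
  have ge: "t \<le> dim (F \<inter> G)" if "G \<in> \<F>" for G
    using S that dim_subset[of "S \<inter> G" "F \<inter> G"] F by (fastforce simp: t_cover_def)
  then have "t_intersecting t (insert F \<F>)"
    using family_intersecting isotropicsD(2)[OF F(1)] t_le by (auto simp: t_intersecting_def Int_commute)
  then have "\<F> = insert F \<F>"
    using family_isotropics F by (intro maximum_family_eq[OF maximum]) auto
  then show ?thesis by auto
qed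

text \<open>All isotropic \<open>m\<close>-spaces through \<open>S\<close> belong to
  \<open>\<F>\<close> by maximality, hence meet \<open>S'\<close> in dimension at least
  \<open>t\<close>. If \<open>S \<inter> S'\<close> were smaller, each would contain an extension of
  \<open>S\<close> inside \<open>S + S'\<close>. There are at most \<open>qnum q (t + 1)\<close>
  extensions, too few for the gap between \<open>N (t + 1)\<close> and
  \<open>N (t + 2)\<close>.\<close>

lemma covers_intersect:
  assumes "S \<in> \<C>" "S' \<in> \<C>" shows "t \<le> dim (S \<inter> S')"
proof (rule ccontr)
  assume "\<not> ?thesis"
  then have less: "dim (S \<inter> S') < t" by simp
  have S: "S \<in> isotropics (t + 1)" "t_cover t \<F> S" and S': "S' \<in> isotropics (t + 1)" "t_cover t \<F> S'"
    using assms by (auto simp: \<C>_def)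
  note D = isotropicsD[OF S(1)] and D' = isotropicsD[OF S'(1)]
  let ?W = "S + S'" and ?G = "{F\<in>isotropics m. S \<subseteq> F}"
  define n where "n = t + 1 - dim (S \<inter> S')"
  have W: "subspace ?W" "S \<subseteq> ?W" "S' \<subseteq> ?W" "dim ?W = dim S + n"
    using D D' dim_set_plus[OF D(1) D'(1)] less by (auto simp: n_def subspace_set_plus subset_set_plus)
  have "\<exists>R\<in>covers_within S ?W. qnum q 1 * real (card ?G) \<le> qnum q n * real (card {F\<in>?G. R \<subseteq> F})"
  proof (rule exists_cover_averaging)
    fix F assume F: "F \<in> ?G"
    then have "subspace F" "t \<le> dim (F \<inter> S')"
      using S' containing_cover_in_family[OF S(2), of F] by (auto simp: t_cover_def Int_commute dest: isotropicsD)
    moreover have "S \<inter> (F \<inter> S') = S \<inter> S'" using F by auto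
    moreover have "dim (S + (F \<inter> S')) + dim (S \<inter> (F \<inter> S')) = dim S + dim (F \<inter> S')"
      using D D' \<open>subspace F\<close> by (intro dim_set_plus subspace_inter)
    moreover have "dim (S + (F \<inter> S')) \<le> dim (F \<inter> ?W)"
      using F W \<open>subspace F\<close> by (intro dim_subset set_plus_subset subspace_inter) auto
    ultimately show "subspace F \<and> S \<subseteq> F \<and> dim S + 1 \<le> dim (F \<inter> ?W)"
      using less F by auto
  qed (use D W less in \<open>auto simp: n_def\<close>)
  then obtain R where R: "subspace R" "dim R = t + 2"
    and le: "real (card ?G) \<le> qnum q n * real (card {F\<in>?G. R \<subseteq> F})"
    using D by (auto simp: covers_within_def)
  have X: "real (card ?G) = N (t + 1)"
    using card_isotropics_containing[OF S(1), of m] t_le by (simp add: N_def)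
  have "real (card {F\<in>?G. R \<subseteq> F}) \<le> N (t + 2)"
    using card_containing_le[of ?G R] R t_le by auto
  moreover have "qnum q n \<le> 2 * q ^ t"
    using qnum_mono[of q n "t + 1"] qnum_bounds(2) by (simp add: n_def)
  ultimately have "N (t + 1) \<le> 2 * q ^ t * N (t + 2)"
    using le X mult_mono[of "qnum q n" "2 * q ^ t" "real (card {F\<in>?G. R \<subseteq> F})" "N (t + 2)"] by simp
  moreover have "2 * q ^ t < q ^ (m + t + 5)"
  proof -
    have "2 * q ^ t < 32 * q ^ t" using q_ge_2 by simp
    also have "\<dots> \<le> (q ^ m * q ^ 5) * q ^ t"
    proof (rule mult_right_mono)
      show "32 \<le> q ^ m * q ^ 5" using mult_mono[of 1 "q ^ m" 32 "q ^ 5"] power_q_5 q_ge_2 by simp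
    qed simp
    finally show ?thesis by (simp add: power_add mult_ac)
  qed
  ultimately show False
    using N_gap N_ge_1[of "t + 2"] mult_strict_right_mono[of "2 * q ^ t" "q ^ (m + t + 5)" "N (t + 2)"] by linarith
qed

lemma classification_common_subspace:
  assumes T: "subspace T" "dim T = t" "\<And>S. S \<in> \<C> \<Longrightarrow> T \<subseteq> S"
  shows "\<exists>U\<in>isotropics m. T \<in> isotropics t \<and> T + U \<in> isotropics (m + 1) \<and> dim (T \<inter> U) = t - 1 \<and> \<F> = H1 m t T U"
proof -
  have C: "S \<in> isotropics (t + 1)" "t_cover t \<F> S" "subspace S" "dim S = t + 1" if "S \<in> \<C>" for S
    using that by (auto simp: \<C>_def dest: isotropicsD)
  have "0 < real (card \<C>)"
    using card_\<C>_gt qnum_nonneg[of q "m - t"] q_ge_0 by linarith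
  then obtain S0 where S0: "S0 \<in> \<C>" by (metis card.empty ex_in_conv less_irrefl of_nat_0)
  have T_iso: "T \<in> isotropics t" using isotropics_subset[OF C(1)[OF S0] T(1) T(3)[OF S0]] T by simp
  \<comment> \<open>\<open>S \<inter> F\<close> has dimension at least \<open>t\<close> and does not
    contain \<open>T\<close>, so adding \<open>T\<close> fills up the
    \<open>(t+1)\<close>-dimensional \<open>S\<close>.\<close>
  have key: "S \<subseteq> T + F" "dim (T \<inter> F) = t - 1" if F: "F \<in> \<F>" "\<not> T \<subseteq> F" and S: "S \<in> \<C>" for F S
  proof -
    have subF: "subspace F" using F family_isotropics by (auto dest: isotropicsD)
    have ge: "t \<le> dim (S \<inter> F)" using C(2)[OF S] F by (auto simp: t_cover_def)
    have sub: "subspace (S \<inter> F)" using subF C(3)[OF S] by (rule subspace_inter[rotated])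
    have "T + (S \<inter> F) \<subseteq> S" using C(3)[OF S] T(3)[OF S] by (intro set_plus_subset) auto
    moreover have "S \<inter> F \<subset> T + (S \<inter> F)"
      using subset_set_plus[OF T(1) sub] F by auto
    then have "dim (S \<inter> F) < dim (T + (S \<inter> F))"
      using sub T by (intro dim_less subspace_set_plus)
    ultimately have eq: "T + (S \<inter> F) = S"
      using C(3,4)[OF S] ge sub T by (intro subspace_eqI subspace_set_plus) auto
    then show "S \<subseteq> T + F" by (metis Int_lower2 order_refl set_plus_mono2)
    have "T \<inter> (S \<inter> F) = T \<inter> F" using T(3)[OF S] by auto
    then have "t + 1 + dim (T \<inter> F) = t + dim (S \<inter> F)"
      using dim_set_plus[OF T(1) sub] eq C(4)[OF S] T by simp
    then show "dim (T \<inter> F) = t - 1"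
      using \<open>dim (S \<inter> F) < dim (T + (S \<inter> F))\<close> eq C(4)[OF S] ge by simp
  qed
  define M where "M = span (\<Union>\<C>)"
  have subM: "subspace M" by (simp add: M_def)
  have CM: "S \<subseteq> M" if "S \<in> \<C>" for S
    using that span_superset[of "\<Union>\<C>"] by (auto simp: M_def)
  have TM: "T \<subseteq> M" using T(3)[OF S0] CM[OF S0] by simp
  have "\<C> \<subseteq> covers_within T M"
  proof
    fix S assume "S \<in> \<C>"
    then show "S \<in> covers_within T M" using C(3,4) T(2,3) CM by (simp add: covers_within_def)
  qed
  \<comment> \<open>The covers are among the extensions of \<open>T\<close> in their span
    \<open>M\<close>, so their number bounds \<open>dim M\<close> from below;
    \<open>M \<subseteq> T + F\<close> with \<open>dim (T + F) = m + 1\<close> then forces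
    equality.\<close>
  then have "real (card \<C>) \<le> qnum q (dim M - t)"
    using card_covers_within[OF T(1) subM TM] T card_mono[of "covers_within T M" \<C>] by simp
  then have "qnum q (m - t) < qnum q (dim M - t)" using card_\<C>_gt by linarith
  then have dimM: "m + 1 \<le> dim M" using qnum_mono[of q "dim M - t" "m - t"] by fastforce
  have M_eq: "T + F = M" and dim_TF: "dim (T + F) = m + 1" if F: "F \<in> \<F>" "\<not> T \<subseteq> F" for F
  proof -
    have D: "subspace F" "dim F = m" using F family_isotropics by (auto dest: isotropicsD)
    show dim: "dim (T + F) = m + 1"
      using dim_set_plus[OF T(1) D(1)] key(2)[OF F S0] T D t_ge_1 by simp
    have "M \<subseteq> T + F" unfolding M_def
      using key(1)[OF F] T D by (intro span_minimal subspace_set_plus) auto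
    then show "T + F = M"
      using dim dimM subM T D by (intro subspace_eqI[symmetric] subspace_set_plus) auto
  qed
  obtain U where U: "U \<in> \<F>" "\<not> T \<subseteq> U"
    using family_nontrivial T unfolding trivial_family_def by blast
  have U_iso: "U \<in> isotropics m" using U family_isotropics by auto
  note DU = isotropicsD[OF U_iso] and DT = isotropicsD[OF T_iso]
  \<comment> \<open>Isotropy of \<open>T + U\<close> reduces to \<open>U\<close> being orthogonal to
    \<open>T\<close>; this holds as \<open>U\<close> lies in the span of isotropic spaces through
    \<open>T\<close>.\<close>
  have "S \<subseteq> perp T" if "S \<in> \<C>" for S
    using isotropicsD(3)[OF C(1)[OF that]] T(3)[OF that] by (auto simp: perp_def)
  then have "M \<subseteq> perp T" unfolding M_def by (intro span_subset_perp) auto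
  moreover have "U \<subseteq> M" using M_eq[OF U] subset_set_plus[OF T(1) DU(1)] by auto
  ultimately have "U \<subseteq> perp T" by simp
  moreover from this have "T \<subseteq> perp U" by (simp add: subset_perp_commute)
  ultimately have "T \<union> U \<subseteq> perp (T \<union> U)"
    using DT DU by (auto simp: perp_def)
  then have "totally_isotropic (span (T \<union> U))" by (rule totally_isotropic_span)
  moreover have "T + U \<subseteq> span (T \<union> U)"
    using span_superset[of "T \<union> U"] by (intro set_plus_subset) auto
  ultimately have "totally_isotropic (T + U)"
    using totally_isotropic_subset subspace_set_plus[OF T(1) DU(1)] by blast
  then have TU: "T + U \<in> isotropics (m + 1)" using dim_TF[OF U] by (simp add: isotropics_def)
  have "\<F> \<subseteq> H1 m t T U"
  proof
    fix F assume F: "F \<in> \<F>"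
    then have F_iso: "F \<in> isotropics m" using family_isotropics by auto
    show "F \<in> H1 m t T U"
    proof (cases "T \<subseteq> F")
      case True
      then show ?thesis using F F_iso U family_intersecting by (auto simp: H1_def t_intersecting_def)
    next
      case False
      then have "F \<subseteq> T + U"
        using M_eq[OF F False] M_eq[OF U] subset_set_plus(2)[OF T(1) isotropicsD(1)[OF F_iso]] by simp
      then show ?thesis using F_iso by (auto simp: H1_def isotropics_within_def)
    qed
  qed
  moreover have "t_intersecting t (H1 m t T U)"
    using t_intersecting_H1[OF T_iso U_iso key(2)[OF U S0] t_ge_1] t_le by simp
  moreover have "H1 m t T U \<subseteq> isotropics m"
    by (auto simp: H1_def isotropics_within_def)
  ultimately have "\<F> = H1 m t T U"
    by (intro maximum_family_eq[OF maximum])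
  then show ?thesis using T_iso U_iso TU key(2)[OF U S0] by blast
qed

lemma classification:
  "(\<exists>T\<in>isotropics t. \<exists>U\<in>isotropics m. T + U \<in> isotropics (m + 1) \<and> dim (T \<inter> U) = t - 1 \<and> \<F> = H1 m t T U)
    \<or> (\<exists>Z\<in>isotropics (t + 2). \<F> = H2 m t Z)"
proof -
  have C: "S \<in> isotropics (t + 1)" "t_cover t \<F> S" "subspace S" "dim S = t + 1" if "S \<in> \<C>" for S
    using that by (auto simp: \<C>_def dest: isotropicsD)
  have "1 < card \<C>" using card_\<C>_gt qnum_ge_1[of q "m - t"] t_le by simp
  then obtain S1 S2 where S: "S1 \<in> \<C>" "S2 \<in> \<C>" "S1 \<noteq> S2"
    by (metis card_le_Suc0_iff_eq finite_set_of_sets One_nat_def not_less)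
  let ?T = "S1 \<inter> S2"
  have T: "subspace ?T" using C S by (simp add: subspace_inter)
  have "?T \<noteq> S1"
    using subspace_eqI[of S1 S2] C(3,4)[OF S(1)] C(3,4)[OF S(2)] S(3) by (metis Int_lower2 order_refl)
  then have "dim ?T < t + 1" using dim_less[OF T, of S1] C S by auto
  then have dimT: "dim ?T = t" using covers_intersect S by (simp add: antisym)
  show ?thesis
  proof (cases "\<forall>S3\<in>\<C>. ?T \<subseteq> S3")
    case True
    then show ?thesis using classification_common_subspace[OF T dimT] by blast
  next
    case False
    then obtain S3 where "S3 \<in> \<C>" "\<not> ?T \<subseteq> S3" by blast
    then have "\<exists>Z\<in>isotropics (t + 2). \<F> = H2 m t Z"
      using S C covers_intersect by (intro maximum_eq_H2_of_triangle[OF maximum, of S1 S2 S3]) auto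
    then show ?thesis by blast
  qed
qed

section \<open>Comparing the two extremal families\<close>

text \<open>The hypothesis says \<open>t + 2 \<le> m - t\<close>, so already the leading term of
  \<open>card_family_gt\<close> is as large as the upper bound for \<open>H2\<close>.\<close>

lemma not_H2:
  assumes "2 * t + 2 \<le> m" "Z \<in> isotropics (t + 2)" shows "\<F> \<noteq> H2 m t Z"
proof
  assume "\<F> = H2 m t Z"
  then have "real (card \<F>) \<le> qnum q (t + 2) * N (t + 1)"
    using card_H2_le[of Z t m] isotropicsD[OF assms(2)] t_le m_le_\<nu> by (simp add: N_def)
  also have "\<dots> \<le> qnum q (m - t) * N (t + 1)"
    using assms N_ge_1[of "t + 1"] by (intro mult_right_mono qnum_mono) auto
  moreover have "0 \<le> qnum q (t + 1) * (qnum q (m + 1 - t))\<^sup>2 * N (t + 2)"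
    using N_ge_1[of "t + 2"] by (simp add: qnum_nonneg)
  ultimately show False using card_family_gt by linarith
qed

text \<open>For \<open>m = 2 t + 1\<close> the two families agree in the leading term, so the terms in \<open>N (t + 2)\<close> decide.\<close>

lemma not_H1:
  assumes m: "m \<le> 2 * t + 1" "\<not> (m = 3 \<and> t = 1)"
    and TU: "T \<in> isotropics t" "U \<in> isotropics m" "T + U \<in> isotropics (m + 1)" "dim (T \<inter> U) = t - 1"
  shows "\<F> \<noteq> H1 m t T U"
proof
  assume eq: "\<F> = H1 m t T U"
  let ?a = "qnum q (m + 1 - t)" and ?X = "N (t + 1)" and ?Y = "N (t + 2)"
  note D = isotropicsD[OF TU(3)] isotropicsD[OF TU(1)] isotropicsD[OF TU(2)]
  have X: "1 \<le> ?X" and Y: "1 \<le> ?Y" by (rule N_ge_1)+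
  have "card \<F> \<le> card (star m t T (T + U)) + card (isotropics_within m (T + U))"
    unfolding eq H1_eq_star[OF TU(1,2,4) t_ge_1] by (rule card_Un_le)
  moreover have "real (card (star m t T (T + U))) \<le> ?a * ?X - q * ?a * ?Y"
    using card_star_le[OF TU(1,3), folded N_def] subset_set_plus[of T U] D t_le by simp
  moreover have "real (card (isotropics_within m (T + U))) \<le> qnum q (m + 1)"
    using card_isotropics_within_le[of "T + U" m] D by simp
  moreover have "qnum q (m + 1) \<le> 2 * q ^ m"
    using qnum_Suc_le[OF q_ge_2, of m] by simp
  ultimately have upper: "real (card \<F>) \<le> ?a * ?X - q * ?a * ?Y + 2 * q ^ m" by linarith
  obtain Z where Z: "Z \<in> isotropics (t + 2)" using exists_isotropic[of "t + 2"] t_le m_le_\<nu> by auto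
  have "nontrivial_t_intersecting m t (H2 m t Z)"
    using nontrivial_H2[OF Z t_ge_1 t_le] t_intersecting_H2[of Z t m] isotropicsD[OF Z] \<nu>_ge m_le_\<nu>
    by (auto simp: nontrivial_t_intersecting_def H2_def)
  then have "card (H2 m t Z) \<le> card \<F>" by (rule family_maximum)
  then have lower: "qnum q (t + 2) * ?X - (qnum q (t + 2) - 1) * ?Y \<le> real (card \<F>)"
    using card_H2_ge[OF Z t_le] by (simp add: N_def)
  have Suc_shift: "qnum q (t + 2) - 1 = q * qnum q (t + 1)"
    using qnum_Suc_shift[of q "t + 1"] by simp
  have qp: "1 \<le> q ^ n" for n using q_ge_2 by simp
  show False
  proof (cases "m = 2 * t + 1")
    case True
    then have a: "?a = qnum q (t + 2)" by (simp add: Suc_diff_le)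
    \<comment> \<open>Excluding \<open>(3, 1)\<close> enters here: \<open>t + 2 < m\<close> makes
      \<open>N (t + 2)\<close> at least \<open>q ^ m\<close>, whereas for \<open>(3, 1)\<close> it
      equals 1 and the final comparison gives no contradiction.\<close>
    have "2 \<le> t" using True m t_ge_1 by linarith
    \<comment> \<open>The terms in \<open>N (t + 1)\<close> cancel. The deficit of \<open>H1\<close>
      exceeds that of \<open>H2\<close> by \<open>q ^ (t + 2) * ?Y\<close>, more than the at most
      \<open>2 * q ^ m\<close> members inside \<open>T + U\<close>.\<close>
    have "q * ?a * ?Y \<le> q * qnum q (t + 1) * ?Y + 2 * q ^ m"
      using upper lower unfolding a Suc_shift by linarith
    moreover have "q * ?a * ?Y = q * qnum q (t + 1) * ?Y + q * q ^ (t + 1) * ?Y"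
      unfolding a using qnum_Suc[of q "t + 1"] by (simp add: algebra_simps)
    ultimately have "q * q ^ (t + 1) * ?Y \<le> 2 * q ^ m" by linarith
    moreover have "q ^ m * 1 \<le> ?Y"
    proof -
      have "q ^ m * 1 \<le> q ^ m * N (t + 3)" using N_ge_1 by (intro mult_left_mono) auto
      also have "\<dots> \<le> ?Y" using N_Suc_le[of "t + 2" m] True \<open>2 \<le> t\<close> \<nu>_ge by (simp add: numeral_3_eq_3)
      finally show ?thesis .
    qed
    moreover have "4 * 1 \<le> q * q ^ (t + 1)"
    proof -
      have "2 * (2 * 1) \<le> q * (q * q ^ t)" using q_ge_2 qp[of t] by (intro mult_mono) auto
      then show ?thesis by simp
    qed
    ultimately have "4 * q ^ m \<le> 2 * q ^ m"
      using mult_mono[of 4 "q * q ^ (t + 1)" "q ^ m" ?Y] by simp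
    then show False using qp[of m] by simp
  next
    case False
    \<comment> \<open>Now \<open>m \<le> 2 * t\<close>, and \<open>H2\<close> leads by a full
      \<open>q ^ (t + 1) * ?X\<close>.\<close>
    then have "?a \<le> qnum q (t + 1)" using m by (intro qnum_mono) auto
    then have "?a * ?X \<le> qnum q (t + 1) * ?X" using X by (intro mult_right_mono) auto
    moreover have "0 \<le> q * ?a * ?Y" using Y by (simp add: qnum_nonneg)
    moreover have "qnum q (t + 2) * ?X = qnum q (t + 1) * ?X + q ^ (t + 1) * ?X"
      using qnum_Suc[of q "t + 1"] by (simp add: algebra_simps)
    ultimately have le: "q ^ (t + 1) * ?X \<le> (q * qnum q (t + 1)) * ?Y + 2 * q ^ m"
      using upper lower unfolding Suc_shift by linarith
    have "(q * qnum q (t + 1)) * ?Y \<le> (q * (2 * q ^ t)) * ?Y"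
      using qnum_bounds(2) Y by (intro mult_right_mono mult_left_mono) auto
    then have le': "q ^ (t + 1) * ?X \<le> 2 * (q ^ (t + 1) * ?Y) + 2 * q ^ m"
      using le by (simp add: mult_ac)
    have gap: "q ^ m * q ^ t * q ^ 5 * ?Y \<le> ?X" using N_gap by (simp only: power_add)
    have "1 * 1 * 32 * ?Y \<le> q ^ m * q ^ t * q ^ 5 * ?Y"
      using power_q_5 qp Y by (intro mult_mono) auto
    with gap have "32 * ?Y \<le> ?X" by simp
    then have "q ^ (t + 1) * (32 * ?Y) \<le> q ^ (t + 1) * ?X" by (intro mult_left_mono) auto
    moreover have "q ^ m * 1 * 32 * 1 \<le> q ^ m * q ^ t * q ^ 5 * ?Y"
      using power_q_5 qp Y by (intro mult_mono) auto
    then have "1 * (32 * q ^ m) \<le> q ^ (t + 1) * ?X"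
      using gap qp[of "t + 1"] by (intro mult_mono) auto
    ultimately have "4 * (q ^ (t + 1) * ?X) \<le> q ^ (t + 1) * ?X"
      using le' by linarith
    moreover have "0 < q ^ (t + 1) * ?X" using qp[of "t + 1"] X by (intro mult_pos_pos) auto
    ultimately show False by linarith
  qed
qed

end

theorem theorem1p1:
  fixes scale :: "'k::{field,finite} \<Rightarrow> 'v::ab_group_add \<Rightarrow> 'v"
    and f :: "'v \<Rightarrow> 'v \<Rightarrow> 'k"
    and \<nu> m t :: nat
    and \<F> :: "'v set set"
  assumes "symplectic_space scale f \<nu>"
    and "t \<ge> 1"
    and "(\<nu> \<ge> m + 1 \<and> m + 1 = t + 2) \<or>
         (2 * \<nu> \<ge> max (3 * m + 2) (2 * m + 2 * t + 6) \<and> m \<ge> t + 2)"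
    and "symplectic_space.maximum_nontrivial_t_intersecting scale f m t \<F>"
  shows "(1 \<le> t \<and> real t \<le> real m / 2 - 1 \<longrightarrow>
            (\<exists>T \<in> symplectic_space.isotropics scale f t.
             \<exists>U \<in> symplectic_space.isotropics scale f m.
               T + U \<in> symplectic_space.isotropics scale f (m + 1) \<and>
               vector_space.dim scale (T \<inter> U) = t - 1 \<and>
               \<F> = symplectic_space.H1 scale f m t T U)) \<and>
         (real m / 2 - 1 < real t \<and> real t \<le> real m - 1 \<longrightarrow>
            (\<exists>Z \<in> symplectic_space.isotropics scale f (t + 2).
               \<F> = symplectic_space.H2 scale f m t Z) \<or>
            (m = 3 \<and> t = 1 \<and>
             (\<exists>T \<in> symplectic_space.isotropics scale f 1.
              \<exists>U \<in> symplectic_space.isotropics scale f 3.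
                T + U \<in> symplectic_space.isotropics scale f 4 \<and>
                vector_space.dim scale (T \<inter> U) = t - 1 \<and>
                \<F> = symplectic_space.H1 scale f 3 1 T U)))"
proof -
  interpret symplectic_space scale f \<nu> by fact
  obtain B where B: "finite B" "span B = UNIV" using finite_dimensional by blast
  \<comment> \<open>The finite-dimensional locale requires an independent spanning set, extracted
    here from the finite spanning set \<open>B\<close>.\<close>
  obtain Basis where Basis: "Basis \<subseteq> B" "independent Basis" "B \<subseteq> span Basis"
    using maximal_independent_subset[of B] by blast
  have "span Basis = UNIV"
    by (metis B(2) Basis(3) span_mono span_span top.extremum_uniqueI)
  then interpret symplectic_counting scale f \<nu> Basis "real CARD('k)"
    using B Basis finite_subset by unfold_locales auto
  have i_iff: "real t \<le> real m / 2 - 1 \<longleftrightarrow> 2 * t + 2 \<le> m" by linarith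
  show ?thesis
  \<comment> \<open>For \<open>m = t + 1\<close> part (i) is vacuous because
    \<open>2 * t + 2 > m\<close>. Otherwise the second alternative of the dimension hypothesis must
    hold.\<close>
  proof (cases "m = t + 1")
    case True
    have "\<exists>Z\<in>isotropics (t + 2). \<F> = H2 m t Z"
      using maximum_eq_H2_codim_1[of t \<F>] assms True by auto
    then show ?thesis using True i_iff by auto
  next
    case False
    interpret maximum_family scale f \<nu> Basis "real CARD('k)" m t \<F>
      using assms False by unfold_locales auto
    show ?thesis
    proof (cases "2 * t + 2 \<le> m")
      case True
      then show ?thesis using classification not_H2 i_iff by auto
    next
      case False
      then have "m \<le> 2 * t + 1" by simp
      then have "(\<exists>Z\<in>isotropics (t + 2). \<F> = H2 m t Z) \<or>
        (m = 3 \<and> t = 1 \<and> (\<exists>T\<in>isotropics 1. \<exists>U\<in>isotropics 3. T + U \<in> isotropics 4 \<and>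
          dim (T \<inter> U) = t - 1 \<and> \<F> = H1 3 1 T U))"
      proof (cases "m = 3 \<and> t = 1")
        case True
        then show ?thesis using classification by auto
      next
        case False
        then show ?thesis using classification not_H1[OF \<open>m \<le> 2 * t + 1\<close> False] by blast
      qed
      then show ?thesis using False i_iff by auto
    qed
  qed
qed

end
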